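(* Let $e\ge 3$ be an odd integer with $e\equiv 3 \pmod 4$, let $q=2^e$, and let $\mathcal{C}^3_\varepsilon:=\mathcal{C}(\mathcal{V}^3_\varepsilon)$ be the projective code over $\mathbb{F}_{q^2}$ generated by the point set $\mathcal{V}^3_\varepsilon\subset\mathrm{PG}(3,q^2)$ (defined in the context, with $r=3$). Then the weights of the non-zero codewords of $\mathcal{C}^3_\varepsilon$ belong to the set $$\{q^5,\ q^5-q^3+3q^2,\ q^5-q^3+2q^2,\ q^5-q^3+3q^2+q-2,\ q^5-q^3+2q^2+q-2\}.$$
   Context: Let $e\ge 3$ be odd, $q=2^e$, $r\ge 2$. Points of $\mathrm{PG}(r,q^2)$ (projective space of projective dimension $r$ over $\mathbb{F}_{q^2}$) have homogeneous coordinates $(X_0,\dots,X_r)$; $\Pi_\infty$ is the hyperplane $X_0=0$, and affine coordinates on the complement $\mathrm{AG}(r,q^2)$ are $x_i=X_i/X_0$. For an exponent involving $\sigma$, $\sigma$ stands for $2^{(e+1)/2}$, i.e. $x^{\sigma}=x^{2^{(e+1)/2}}$ and $x^{\sigma+2}=x^{2^{(e+1)/2}+2}$. Fix $\varepsilon\in\mathbb{F}_{q^2}\setminus\mathbb{F}_q$ such that $\varepsilon^2+\varepsilon+\delta=0$ for some $\delta\in\mathbb{F}_q\setminus\{1\}$ with absolute trace $\mathrm{Tr}_{q/2}(\delta)=\sum_{i=0}^{e-1}\delta^{2^i}=1$. Put $$\Gamma_{\varepsilon}(x)=[x+(x^q+x)\varepsilon]^{\sigma+2}+(x^q+x)^{\sigma}+(x^{2q}+x^2)\varepsilon+x^{q+1}+x^2.$$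 $\mathcal{V}^r_\varepsilon$ is the projective hypersurface of $\mathrm{PG}(r,q^2)$ with affine equation $x_r^q+x_r=\Gamma_{\varepsilon}(x_1)+\dots+\Gamma_{\varepsilon}(x_{r-1})$, i.e. the zero locus of the homogenization (with respect to $X_0$) of the corresponding polynomial; it is identified with its set of $\mathbb{F}_{q^2}$-rational points. For a set $\Omega$ of $N$ points of $\mathrm{PG}(r,q^2)$, $\mathcal{C}(\Omega)$ is the linear code of length $N$ over $\mathbb{F}_{q^2}$ spanned by the rows of an $(r+1)\times N$ matrix whose columns are coordinate vectors of the points of $\Omega$ (one representative per point); it is unique up to monomial equivalence. The weight of a codeword is its Hamming weight. *)

theory Defs
  imports
    "HOL-Library.Poly_Mapping"
    "Jordan_Normal_Form.VS_Connect"
begin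

section \<open>Multivariate polynomials and homogenization\<close>

text \<open>
  A monomial is a finitely supported exponent function; ring operations are those of
  \<^theory>\<open>HOL-Library.Poly_Mapping\<close>. The variables are \<open>X\<^sub>0, X\<^sub>1, \<dots>\<close>.
\<close>

type_synonym 'a mvpoly = "(nat \<Rightarrow>\<^sub>0 nat) \<Rightarrow>\<^sub>0 'a"

definition pvar :: "nat \<Rightarrow> 'a::comm_ring_1 mvpoly"
  where "pvar i = Poly_Mapping.single (Poly_Mapping.single i 1) 1"

definition pconst :: "'a::comm_ring_1 \<Rightarrow> 'a mvpoly"
  where "pconst c = Poly_Mapping.single 0 c"

definition monom_degree :: "(nat \<Rightarrow>\<^sub>0 nat) \<Rightarrow> nat"
  where "monom_degree m = (\<Sum>i\<in>Poly_Mapping.keys m. Poly_Mapping.lookup m i)"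

definition total_degree :: "'a::comm_ring_1 mvpoly \<Rightarrow> nat"
  where "total_degree p = Max (insert 0 (monom_degree ` Poly_Mapping.keys p))"

definition eval_mvpoly :: "'a::comm_ring_1 mvpoly \<Rightarrow> (nat \<Rightarrow> 'a) \<Rightarrow> 'a"
  where "eval_mvpoly p x =
    (\<Sum>m\<in>Poly_Mapping.keys p.
      Poly_Mapping.lookup p m * (\<Prod>i\<in>Poly_Mapping.keys m. x i ^ Poly_Mapping.lookup m i))"

text \<open>Homogenization with respect to \<open>X\<^sub>0\<close>, meant for polynomials in which \<open>X\<^sub>0\<close> does not occur.\<close>

definition homogenize :: "'a::comm_ring_1 mvpoly \<Rightarrow> 'a mvpoly"
  where "homogenize p =
    (\<Sum>m\<in>Poly_Mapping.keys p.
      Poly_Mapping.single (m + Poly_Mapping.single 0 (total_degree p - monom_degree m))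
        (Poly_Mapping.lookup p m))"

section \<open>Projective space\<close>

text \<open>
  A point of projective \<open>r\<close>-space is the set of all its (nonzero) coordinate vectors
  \<open>(X\<^sub>0, \<dots>, X\<^sub>r)\<close>.
\<close>

definition proj_point :: "'a::field vec \<Rightarrow> 'a vec set"
  where "proj_point v = {c \<cdot>\<^sub>v v | c. c \<noteq> 0}"

definition PG :: "nat \<Rightarrow> 'a::field vec set set"
  where "PG r = {proj_point v | v. v \<in> carrier_vec (r + 1) \<and> v \<noteq> 0\<^sub>v (r + 1)}"

definition proj_zero_locus :: "nat \<Rightarrow> 'a::field mvpoly \<Rightarrow> 'a vec set set"
  where "proj_zero_locus r F = {P \<in> PG r. \<forall>v\<in>P. eval_mvpoly F (\<lambda>i. v $ i) = 0}"

section \<open>The variety\<close>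

text \<open>The subfield of order \<open>q\<close> of a field of order \<open>q\<^sup>2\<close>, as the fixed field of \<open>x \<mapsto> x\<^sup>q\<close>.\<close>

definition subfield_Fq :: "nat \<Rightarrow> 'a::field set"
  where "subfield_Fq q = {x. x ^ q = x}"

definition abs_trace :: "nat \<Rightarrow> 'a::field \<Rightarrow> 'a"
  where "abs_trace e d = (\<Sum>i<e. d ^ (2 ^ i))"

definition sigma_exp :: "nat \<Rightarrow> nat"
  where "sigma_exp e = 2 ^ ((e + 1) div 2)"

text \<open>
  Stated over an arbitrary commutative ring, so that the same expression can be used on
  field elements and on polynomials.
\<close>

definition Gamma :: "nat \<Rightarrow> 'b::comm_ring_1 \<Rightarrow> 'b \<Rightarrow> 'b"
  where "Gamma e \<epsilon> x =
    (let q = 2 ^ e; \<sigma> = sigma_exp e in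
      (x + (x ^ q + x) * \<epsilon>) ^ (\<sigma> + 2) + (x ^ q + x) ^ \<sigma>
        + (x ^ (2 * q) + x ^ 2) * \<epsilon> + x ^ (q + 1) + x ^ 2)"

definition affine_poly :: "nat \<Rightarrow> nat \<Rightarrow> 'a::field \<Rightarrow> 'a mvpoly"
  where "affine_poly e r \<epsilon> =
    pvar r ^ (2 ^ e) + pvar r - (\<Sum>i=1..r - 1. Gamma e (pconst \<epsilon>) (pvar i))"

definition variety :: "nat \<Rightarrow> nat \<Rightarrow> 'a::field \<Rightarrow> 'a vec set set"
  where "variety e r \<epsilon> = proj_zero_locus r (homogenize (affine_poly e r \<epsilon>))"

section \<open>The code of a point set\<close>

text \<open>
  \<open>C(\<Omega>)\<close> depends on the ordering of the points and on the chosen coordinate vectors;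
  each such choice is a matrix \<open>G\<close> as follows, and the code is the row space of \<open>G\<close>.
\<close>

definition generates_code_of :: "nat \<Rightarrow> 'a::field vec set set \<Rightarrow> 'a mat \<Rightarrow> bool"
  where "generates_code_of r \<Omega> G \<longleftrightarrow>
    G \<in> carrier_mat (r + 1) (card \<Omega>) \<and>
    bij_betw (\<lambda>j. proj_point (col G j)) {..<card \<Omega>} \<Omega>"

definition lin_code :: "'a::field mat \<Rightarrow> 'a vec set"
  where "lin_code G = vec_space.row_space (dim_col G) G"

definition hamming_weight :: "'a::zero vec \<Rightarrow> nat"
  where "hamming_weight c = card {i. i < dim_vec c \<and> c $ i \<noteq> 0}"

end

theory Submission
  imports Defs "HOL-Computational_Algebra.Primes"
begin

text \<open>
  Write \<open>x = a + b \<epsilon>\<close> with \<open>a, b\<close> in the subfield of order \<open>q\<close>. Then \<open>x\<^sup>q + x = b\<close>, and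
  \<open>\<Gamma>(x)\<close> becomes the function \<open>a\<close>^\<open>(\<sigma> + 2) + a b + b\<^sup>\<sigma>\<close> of the Tits ovoid.
  Together with any linear functional it takes one value once and all others \<open>q + 1\<close> times:
  translations of the Suzuki group absorb the functional, and
  \<open>(a, b) \<mapsto> (k a, k\<close>^\<open>(\<sigma> + 1) b)\<close> permutes the nonzero values transitively.
  Convolving two such functions gives the number of affine points on a plane that misses
  the point \<open>(0, 0, 0, 1)\<close>; the planes through it contain \<open>q\<^sup>3\<close> affine points or none. At infinity the
  top form \<open>X\<^sub>1\<close>^\<open>(q (\<sigma> + 2)) + X\<^sub>2\<close>^\<open>(q (\<sigma> + 2))\<close> vanishes on \<open>gcd(\<sigma> + 2, q\<^sup>2 - 1) = 3\<close>
  lines through \<open>(0, 0, 0, 1)\<close>.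
\<close>

section \<open>Restricting multivariate polynomials to lines\<close>

definition monom_eval :: "(nat \<Rightarrow> 'a::comm_ring_1) \<Rightarrow> (nat \<Rightarrow>\<^sub>0 nat) \<Rightarrow> 'a"
  where "monom_eval v m = (\<Prod>i\<in>Poly_Mapping.keys m. v i ^ Poly_Mapping.lookup m i)"

lemma monom_eval_superset:
  assumes "finite S" "Poly_Mapping.keys m \<subseteq> S"
  shows "monom_eval v m = (\<Prod>i\<in>S. v i ^ Poly_Mapping.lookup m i)"
  unfolding monom_eval_def
  by (rule prod.mono_neutral_left) (use assms in \<open>auto simp: in_keys_iff\<close>)

lemma monom_eval_plus: "monom_eval v (m + n) = monom_eval v m * monom_eval v n"
proof -
  let ?S = "Poly_Mapping.keys m \<union> Poly_Mapping.keys n"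
  have "Poly_Mapping.keys (m + n) \<subseteq> ?S" by (rule Poly_Mapping.keys_add)
  then show ?thesis
    by (simp add: monom_eval_superset[of ?S] lookup_add power_add prod.distrib)
qed

lemma monom_eval_0 [simp]: "monom_eval v 0 = 1"
  by (simp add: monom_eval_def)

lemma monom_eval_single: "monom_eval v (Poly_Mapping.single i k) = v i ^ k"
  by (simp add: monom_eval_def)

lemma monom_degree_superset:
  assumes "finite S" "Poly_Mapping.keys m \<subseteq> S"
  shows "monom_degree m = (\<Sum>i\<in>S. Poly_Mapping.lookup m i)"
  unfolding monom_degree_def
  by (rule sum.mono_neutral_left) (use assms in \<open>auto simp: in_keys_iff\<close>)

lemma monom_degree_plus: "monom_degree (m + n) = monom_degree m + monom_degree n"
proof -
  let ?S = "Poly_Mapping.keys m \<union> Poly_Mapping.keys n"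
  have "Poly_Mapping.keys (m + n) \<subseteq> ?S" by (rule Poly_Mapping.keys_add)
  then show ?thesis
    by (simp add: monom_degree_superset[of ?S] lookup_add sum.distrib)
qed

lemma monom_degree_0 [simp]: "monom_degree 0 = 0"
  by (simp add: monom_degree_def)

lemma monom_degree_single [simp]: "monom_degree (Poly_Mapping.single i k) = k"
  by (simp add: monom_degree_def)

lemma monom_eval_scale: "monom_eval (\<lambda>i. t * v i) m = t ^ monom_degree m * monom_eval v m"
  by (simp add: monom_eval_def monom_degree_def power_mult_distrib prod.distrib power_sum)

text \<open>The restriction of \<open>p\<close> to the line through the origin spanned by \<open>v\<close>, as a univariate polynomial.\<close>

definition line_poly :: "(nat \<Rightarrow> 'a::comm_ring_1) \<Rightarrow> 'a mvpoly \<Rightarrow> 'a poly"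
  where "line_poly v p =
    (\<Sum>m\<in>Poly_Mapping.keys p. monom (Poly_Mapping.lookup p m * monom_eval v m) (monom_degree m))"

lemma line_poly_superset:
  assumes "finite S" "Poly_Mapping.keys p \<subseteq> S"
  shows "line_poly v p =
    (\<Sum>m\<in>S. monom (Poly_Mapping.lookup p m * monom_eval v m) (monom_degree m))"
  unfolding line_poly_def
  by (rule sum.mono_neutral_left) (use assms in \<open>auto simp: in_keys_iff\<close>)

lemma line_poly_0 [simp]: "line_poly v 0 = 0"
  by (simp add: line_poly_def)

lemma line_poly_add: "line_poly v (p + r) = line_poly v p + line_poly v r"
proof -
  let ?S = "Poly_Mapping.keys p \<union> Poly_Mapping.keys r"
  have "Poly_Mapping.keys (p + r) \<subseteq> ?S" by (rule Poly_Mapping.keys_add)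
  then show ?thesis
    by (simp add: line_poly_superset[of ?S] lookup_add distrib_right sum.distrib flip: add_monom)
qed

lemma line_poly_sum: "line_poly v (sum f A) = (\<Sum>a\<in>A. line_poly v (f a))"
  by (induction A rule: infinite_finite_induct) (auto simp: line_poly_add)

lemma line_poly_diff: "line_poly v (p - r) = line_poly v p - line_poly v r"
  using line_poly_add[of v "p - r" r] by (simp add: algebra_simps)

lemma line_poly_single:
  "line_poly v (Poly_Mapping.single m c) = monom (c * monom_eval v m) (monom_degree m)"
  by (simp add: line_poly_def)

lemma sum_single_lookup:
  "(\<Sum>m\<in>Poly_Mapping.keys p. Poly_Mapping.single m (Poly_Mapping.lookup p m)) = p"
  by (rule poly_mapping_eqI)
     (auto simp: lookup_sum lookup_single when_def in_keys_iff)

text \<open>Degrees add and values multiply under products of monomials, so expanding both factors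
  into single terms suffices. This makes \<open>line_poly v\<close> a ring homomorphism, which
  carries long expressions over unexpanded.\<close>

lemma line_poly_mult: "line_poly v (p * r) = line_poly v p * line_poly v r"
proof -
  have "p * r = (\<Sum>m\<in>Poly_Mapping.keys p. Poly_Mapping.single m (Poly_Mapping.lookup p m)) *
     (\<Sum>n\<in>Poly_Mapping.keys r. Poly_Mapping.single n (Poly_Mapping.lookup r n))"
    by (simp only: sum_single_lookup)
  also have "\<dots> = (\<Sum>m\<in>Poly_Mapping.keys p. \<Sum>n\<in>Poly_Mapping.keys r.
     Poly_Mapping.single (m + n) (Poly_Mapping.lookup p m * Poly_Mapping.lookup r n))"
    by (simp add: sum_product mult_single)
  also have "line_poly v \<dots> = line_poly v p * line_poly v r"
    unfolding line_poly_sum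
    by (simp add: line_poly_def[of v p] line_poly_def[of v r] sum_product line_poly_single
        mult_monom monom_eval_plus monom_degree_plus mult_ac)
  finally show ?thesis .
qed

lemma line_poly_1 [simp]: "line_poly v 1 = 1"
  by (simp add: line_poly_def)

lemma line_poly_power: "line_poly v (p ^ k) = line_poly v p ^ k"
  by (induction k) (auto simp: line_poly_mult)

lemma line_poly_pvar: "line_poly v (pvar i) = monom (v i) 1"
  by (simp add: pvar_def line_poly_single monom_eval_single)

lemma line_poly_pconst: "line_poly v (pconst c) = [:c:]"
  by (simp add: pconst_def line_poly_single monom_0)

section \<open>Evaluation of a polynomial and of its homogenization\<close>

lemma eval_mvpoly_conv:
  "eval_mvpoly p v = (\<Sum>m\<in>Poly_Mapping.keys p. Poly_Mapping.lookup p m * monom_eval v m)"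
  by (simp add: eval_mvpoly_def monom_eval_def)

lemma eval_mvpoly_conv_line_poly: "eval_mvpoly p v = poly (line_poly v p) 1"
  by (simp add: eval_mvpoly_conv line_poly_def poly_sum poly_monom)

lemma eval_homogenize:
  "eval_mvpoly (homogenize p) v = (\<Sum>m\<in>Poly_Mapping.keys p.
     Poly_Mapping.lookup p m * monom_eval v m * v 0 ^ (total_degree p - monom_degree m))"
  by (simp add: eval_mvpoly_conv_line_poly homogenize_def line_poly_sum line_poly_single
      poly_sum poly_monom monom_eval_plus monom_eval_single mult_ac)

lemma monom_degree_le_total_degree:
  "m \<in> Poly_Mapping.keys p \<Longrightarrow> monom_degree m \<le> total_degree p"
  unfolding total_degree_def by (intro Max_ge) auto

text \<open>In a polynomial of degree D, a monomial of degree d takes \<open>v 0 ^ d\<close> from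
  rescaling its variables and \<open>v 0 ^ (D - d)\<close> from homogenizing, hence always
  \<open>v 0 ^ D\<close>.\<close>

lemma eval_homogenize_affine:
  fixes p :: "'a::field mvpoly"
  assumes "v 0 \<noteq> 0"
  shows "eval_mvpoly (homogenize p) v = v 0 ^ total_degree p * eval_mvpoly p (\<lambda>i. v i / v 0)"
proof -
  have "monom_eval v m = v 0 ^ monom_degree m * monom_eval (\<lambda>i. v i / v 0) m" for m
    using monom_eval_scale[of "v 0" "\<lambda>i. v i / v 0" m] assms by simp
  moreover have "v 0 ^ monom_degree m * v 0 ^ (total_degree p - monom_degree m) = v 0 ^ total_degree p"
    if "m \<in> Poly_Mapping.keys p" for m
    using monom_degree_le_total_degree[OF that] by (simp flip: power_add)
  ultimately show ?thesis
    unfolding eval_homogenize eval_mvpoly_conv[of p] sum_distrib_left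
    by (intro sum.cong) (auto simp: mult_ac)
qed

text \<open>The power \<open>0 ^ (D - d)\<close> is 1 for d = D and 0 for d < D, so only the top
  form survives.\<close>

lemma eval_homogenize_infinity:
  assumes "v 0 = 0"
  shows "eval_mvpoly (homogenize p) v = coeff (line_poly v p) (total_degree p)"
proof -
  have "Poly_Mapping.lookup p m * monom_eval v m * v 0 ^ (total_degree p - monom_degree m) =
      coeff (monom (Poly_Mapping.lookup p m * monom_eval v m) (monom_degree m)) (total_degree p)"
    if "m \<in> Poly_Mapping.keys p" for m
    using monom_degree_le_total_degree[OF that] assms by (auto simp: power_0_left)
  then show ?thesis
    by (simp add: eval_homogenize line_poly_def coeff_sum)
qed

section \<open>Total degrees and top coefficients\<close>

lemma total_degree_le_iff:
  "total_degree p \<le> d \<longleftrightarrow> (\<forall>m\<in>Poly_Mapping.keys p. monom_degree m \<le> d)"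
  by (auto simp: total_degree_def)

lemma total_degree_add_le: "total_degree p \<le> d \<Longrightarrow> total_degree r \<le> d \<Longrightarrow> total_degree (p + r) \<le> d"
  using Poly_Mapping.keys_add[of p r] by (fastforce simp: total_degree_le_iff)

lemma total_degree_diff_le: "total_degree p \<le> d \<Longrightarrow> total_degree r \<le> d \<Longrightarrow> total_degree (p - r) \<le> d"
  unfolding total_degree_le_iff by (metis diff_0_right in_keys_iff lookup_minus)

lemma total_degree_mult_le:
  assumes "total_degree p \<le> d" "total_degree r \<le> d'"
  shows "total_degree (p * r) \<le> d + d'"
  using Poly_Mapping.keys_mult[of p r] assms
  by (fastforce simp: total_degree_le_iff monom_degree_plus
       intro: add_mono)

lemma total_degree_1 [simp]: "total_degree (1 :: 'a::comm_ring_1 mvpoly) = 0"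
  by (simp add: total_degree_def)

lemma total_degree_power_le:
  assumes "total_degree p \<le> d" "d * k \<le> d'"
  shows "total_degree (p ^ k) \<le> d'"
proof -
  have "total_degree (p ^ k) \<le> d * k"
    by (induction k) (use assms(1) total_degree_mult_le[of p d] in auto)
  then show ?thesis using assms by simp
qed

lemma total_degree_pvar_le: "total_degree (pvar i :: 'a::comm_ring_1 mvpoly) \<le> 1"
  by (simp add: total_degree_def pvar_def)

lemma total_degree_pconst: "total_degree (pconst c) = 0"
  by (simp add: total_degree_def pconst_def)

lemma total_degree_geI:
  assumes "coeff (line_poly v p) d \<noteq> 0"
  shows "d \<le> total_degree p"
proof -
  have "\<exists>m\<in>Poly_Mapping.keys p. monom_degree m = d"
  proof (rule ccontr)
    assume "\<not> ?thesis"
    then have "coeff (line_poly v p) d = 0"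
      by (auto simp: line_poly_def coeff_sum intro!: sum.neutral)
    with assms show False by simp
  qed
  then show ?thesis using monom_degree_le_total_degree by blast
qed

text \<open>If one of the degree bounds is not attained, both sides are 0. Top coefficients can thus
  be computed before they are known to be nonzero.\<close>

lemma coeff_mult_degree_le:
  assumes "degree p \<le> a" "degree r \<le> b"
  shows "coeff (p * r) (a + b) = coeff p a * coeff r b"
proof (cases "degree p = a \<and> degree r = b")
  case True then show ?thesis using coeff_mult_degree_sum[of p r] by auto
next
  case False
  then have "degree p + degree r < a + b" using assms by linarith
  moreover have "coeff p a = 0 \<or> coeff r b = 0" using False assms
    by (metis coeff_eq_0 le_neq_implies_less)
  ultimately show ?thesis using degree_mult_le[of p r]
    by (metis (no_types, opaque_lifting) coeff_eq_0 le_less_trans mult_not_zero)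
qed

lemma coeff_power_degree_le:
  fixes p :: "'a::comm_ring_1 poly"
  assumes "degree p \<le> a"
  shows "coeff (p ^ k) (a * k) = coeff p a ^ k"
proof (induction k)
  case (Suc k)
  have "degree (p ^ k) \<le> a * k"
    using degree_power_le[of p k] mult_le_mono1[OF assms, of k] by linarith
  then show ?case using coeff_mult_degree_le[OF assms, of "p ^ k" "a * k"] Suc by simp
qed simp

section \<open>The Tits ovoid over a quadratic extension\<close>

text \<open>Multiplication by a nonzero x permutes the nonzero elements; comparing their products
  shows that x raised to their number is 1.\<close>

lemma finite_field_power_card:
  fixes x :: "'a::{field,finite}"
  shows "x ^ card (UNIV :: 'a set) = x"
proof (cases "x = 0")
  case False
  let ?U = "UNIV - {0 :: 'a}"
  have "bij_betw ((*) x) ?U ?U"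
    by (rule bij_betwI[of _ _ _ "\<lambda>y. y / x"]) (use False in auto)
  then have "\<Prod>?U = (\<Prod>y\<in>?U. x * y)"
    by (rule prod.reindex_bij_betw[symmetric, where g = "\<lambda>y. y"])
  also have "\<dots> = x ^ card ?U * \<Prod>?U"
    by (simp add: prod.distrib)
  finally have "x ^ card ?U = 1" by simp
  moreover have "card (UNIV :: 'a set) = Suc (card ?U)"
    by (metis UNIV_I card_Suc_Diff1 finite_code)
  ultimately show ?thesis by (simp only: power_Suc mult_1_right)
qed (simp add: card_gt_0_iff)

locale fq2 =
  fixes e q :: nat and \<epsilon> \<delta> :: "'a::{field,finite}"
  assumes odd_e: "odd e" and q_def: "q = 2 ^ e"
    and card_UNIV: "card (UNIV :: 'a set) = q ^ 2"
    and eps_notin: "\<epsilon> \<notin> subfield_Fq q"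
    and delta_in: "\<delta> \<in> subfield_Fq q"
    and trace_delta: "abs_trace e \<delta> = 1"
    and eps_root: "\<epsilon> ^ 2 + \<epsilon> + \<delta> = 0"
begin

abbreviation Fq :: "'a set" where "Fq \<equiv> subfield_Fq q"
abbreviation \<sigma> :: nat where "\<sigma> \<equiv> sigma_exp e"

text \<open>The shift by 1 permutes the field, so the sum of 1 over all elements is 0. That sum is
  \<open>q ^ 2\<close>, a power of 2.\<close>

lemma two_eq_0: "(2 :: 'a) = 0"
proof -
  have "(\<Sum>x\<in>UNIV. x + 1) = (\<Sum>x\<in>UNIV. x :: 'a)"
    by (rule sum.reindex_bij_witness[of _ "\<lambda>x. x - 1" "\<lambda>x. x + 1"]) auto
  then have "of_nat (card (UNIV :: 'a set)) = (0 :: 'a)" by (simp add: sum.distrib)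
  then show ?thesis by (simp add: card_UNIV q_def flip: power_mult)
qed

lemma CHAR_eq_2: "CHAR('a) = 2"
proof -
  have "CHAR('a) dvd 2"
    using two_eq_0 of_nat_eq_0_iff_char_dvd[where ?'a = 'a, of 2] by simp
  moreover have "CHAR('a) \<noteq> 1" using CHAR_not_1' by simp
  ultimately show ?thesis by (metis prime_nat_iff two_is_prime_nat)
qed

lemma add_self [simp]: "x + x = (0 :: 'a)"
  using two_eq_0 by (metis mult_2 mult_zero_left)

lemma add_self_left [simp]: "x + (x + y) = (y :: 'a)"
  by (simp flip: add.assoc)

lemma minus_eq: "- x = (x :: 'a)"
  by (metis add_self minus_unique)

lemma diff_eq_plus: "x - y = x + (y :: 'a)"
  by (metis diff_conv_add_uminus minus_eq)

lemma add_eq_0_iff_eq: "x + y = 0 \<longleftrightarrow> x = (y :: 'a)"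
  by (metis diff_eq_plus right_minus_eq)

lemma add_eq_iff: "x + y = z \<longleftrightarrow> x = z + (y :: 'a)"
  by (metis add.assoc add_self add.right_neutral)

lemma frobenius_add: "(x + y) ^ (2 ^ n) = x ^ (2 ^ n) + (y :: 'a) ^ (2 ^ n)"
  by (rule freshmans_dream') (auto simp: CHAR_eq_2)

lemma square_add: "(x + y)\<^sup>2 = x\<^sup>2 + (y :: 'a)\<^sup>2"
  using frobenius_add[of x y 1] by simp

lemma frobenius_sum: "(\<Sum>i\<in>A. f i) ^ (2 ^ n) = (\<Sum>i\<in>A. (f i :: 'a) ^ (2 ^ n))"
  by (rule freshmans_dream_sum') (auto simp: CHAR_eq_2)

lemma frobenius_inj: "x ^ (2 ^ n) = y ^ (2 ^ n) \<longleftrightarrow> x = (y :: 'a)"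
proof
  assume "x ^ (2 ^ n) = y ^ (2 ^ n)"
  then have "(x + y) ^ (2 ^ n) = 0" by (simp add: frobenius_add)
  then show "x = y" by (simp add: add_eq_0_iff_eq)
qed simp

lemma power_q_add: "(x + y) ^ q = x ^ q + (y :: 'a) ^ q"
  unfolding q_def by (rule frobenius_add)

lemma power_sigma_add: "(x + y) ^ \<sigma> = x ^ \<sigma> + (y :: 'a) ^ \<sigma>"
  unfolding sigma_exp_def by (rule frobenius_add)

lemma power_q_q: "(x ^ q) ^ q = (x :: 'a)"
  using finite_field_power_card[of x] by (simp add: card_UNIV power2_eq_square power_mult)

lemma Fq_iff: "x \<in> Fq \<longleftrightarrow> x ^ q = x"
  by (simp add: subfield_Fq_def)

lemma Fq_closed [simp, intro]:
  "0 \<in> Fq" "1 \<in> Fq"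
  "x \<in> Fq \<Longrightarrow> y \<in> Fq \<Longrightarrow> x + y \<in> Fq"
  "x \<in> Fq \<Longrightarrow> y \<in> Fq \<Longrightarrow> x * y \<in> Fq"
  "x \<in> Fq \<Longrightarrow> y \<in> Fq \<Longrightarrow> x / y \<in> Fq"
  "x \<in> Fq \<Longrightarrow> x ^ n \<in> Fq"
  by (auto simp: Fq_iff power_q_add power_mult_distrib power_divide power_0_left)
     (simp_all add: q_def flip: power_mult, metis mult.commute power_mult)

text \<open>For odd e the square of \<sigma> is 2q, so on \<open>Fq\<close> the \<sigma>-th power is
  a square root of the Frobenius map.\<close>

lemma sigma_sigma: "x \<in> Fq \<Longrightarrow> (x ^ \<sigma>) ^ \<sigma> = x\<^sup>2"
proof -
  assume x: "x \<in> Fq"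
  have "\<sigma> * \<sigma> = q * 2"
    using odd_e by (auto simp: sigma_exp_def q_def simp flip: power_add elim!: oddE)
  then show ?thesis
    using x by (metis Fq_iff power_mult)
qed

text \<open>The relative trace onto \<open>Fq\<close>; \<open>re x\<close> and \<open>tr x\<close>
  are the coordinates of x in the basis 1, \<epsilon>.\<close>

definition tr :: "'a \<Rightarrow> 'a" where "tr x = x ^ q + x"
definition re :: "'a \<Rightarrow> 'a" where "re x = x + tr x * \<epsilon>"

text \<open>As \<delta> lies in \<open>Fq\<close>, \<open>\<epsilon> ^ q\<close> is a root of the
  same quadratic. The difference of the two roots equals its own square and is nonzero since
  \<epsilon> is outside \<open>Fq\<close>, so it is 1.\<close>

lemma eps_conj: "\<epsilon> ^ q = \<epsilon> + 1"
proof -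
  let ?d = "\<epsilon> ^ q + \<epsilon>"
  have "(\<epsilon> ^ 2 + \<epsilon> + \<delta>) ^ q = 0" using eps_root by (simp add: q_def power_0_left)
  then have "(\<epsilon> ^ q) ^ 2 + \<epsilon> ^ q + \<delta> = 0"
    using delta_in by (simp add: power_q_add Fq_iff power_mult[symmetric] mult.commute)
  then have "(\<epsilon> ^ q) ^ 2 = \<epsilon> ^ q + \<delta>" by (simp add: add_eq_0_iff_eq add.assoc)
  moreover have "\<epsilon> ^ 2 = \<epsilon> + \<delta>" using eps_root by (simp add: add_eq_0_iff_eq add.assoc)
  ultimately have "?d ^ 2 = ?d" by (simp add: square_add add_ac)
  then have "?d * (?d + 1) = 0" by (simp add: algebra_simps power2_eq_square)
  moreover have "?d \<noteq> 0" using eps_notin by (simp add: Fq_iff add_eq_0_iff_eq)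
  ultimately have "?d = 1" by (simp add: add_eq_0_iff_eq)
  then show ?thesis unfolding add_eq_iff by (simp add: add.commute)
qed

lemma tr_in_Fq [simp]: "tr x \<in> Fq"
  by (simp add: tr_def Fq_iff power_q_add power_q_q add.commute)

lemma re_in_Fq [simp]: "re x \<in> Fq"
proof -
  have "re x ^ q = x ^ q + tr x * (\<epsilon> + 1)"
    using tr_in_Fq[of x] unfolding Fq_iff by (simp add: re_def power_q_add power_mult_distrib eps_conj)
  also have "\<dots> = re x" by (simp add: re_def tr_def algebra_simps)
  finally show ?thesis by (simp add: Fq_iff)
qed

lemma tr_add: "tr (x + y) = tr x + tr y"
  by (simp add: tr_def power_q_add add_ac)

lemma tr_mult_Fq: "a \<in> Fq \<Longrightarrow> tr (a * x) = a * tr x"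
  by (simp add: tr_def Fq_iff power_mult_distrib algebra_simps)

lemma tr_Fq: "a \<in> Fq \<Longrightarrow> tr a = 0"
  by (simp add: tr_def Fq_iff)

lemma tr_eps: "tr \<epsilon> = 1"
  by (simp add: tr_def eps_conj add_ac flip: add.assoc)

lemma tr_coord: "a \<in> Fq \<Longrightarrow> b \<in> Fq \<Longrightarrow> tr (a + b * \<epsilon>) = b"
  by (simp add: tr_add tr_mult_Fq tr_Fq tr_eps)

lemma re_coord: "a \<in> Fq \<Longrightarrow> b \<in> Fq \<Longrightarrow> re (a + b * \<epsilon>) = a"
  by (simp add: re_def tr_coord add.assoc)

lemma coord: "re x + tr x * \<epsilon> = x"
  by (simp add: re_def add.assoc)

lemma bij_coord: "bij_betw (\<lambda>x. (re x, tr x)) UNIV (Fq \<times> Fq)"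
  by (rule bij_betwI[of _ _ _ "\<lambda>(a, b). a + b * \<epsilon>"]) (auto simp: re_coord tr_coord coord)

lemma card_Fq: "card Fq = q"
proof -
  have "card Fq ^ 2 = q ^ 2"
    using bij_betw_same_card[OF bij_coord] by (simp add: card_UNIV card_cartesian_product power2_eq_square)
  then show ?thesis by (simp add: power2_eq_iff_nonneg)
qed

lemma card_tr_fiber:
  assumes "d \<in> Fq"
  shows "card {x. tr x = d} = q"
proof -
  have "bij_betw re {x. tr x = d} Fq"
    by (rule bij_betwI[of _ _ _ "\<lambda>a. a + d * \<epsilon>"])
       (use assms in \<open>auto simp: re_coord tr_coord coord\<close>)
  then show ?thesis using bij_betw_same_card card_Fq by metis
qed

lemma q_gt_0 [simp]: "q > 0"
  by (simp add: q_def)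

section \<open>The function of the Tits ovoid, its scalings and its fibers\<close>

definition tits :: "'a \<Rightarrow> 'a \<Rightarrow> 'a"
  where "tits a b = a ^ (\<sigma> + 2) + a * b + b ^ \<sigma>"

lemma tits_in_Fq [simp]: "a \<in> Fq \<Longrightarrow> b \<in> Fq \<Longrightarrow> tits a b \<in> Fq"
  by (simp add: tits_def)

text \<open>Here \<open>x ^ (2 * q) + x ^ 2\<close> is the square of \<open>tr x\<close> and
  \<open>x ^ (q + 1) + x ^ 2\<close> is \<open>x * tr x\<close>; with the factor \<epsilon> they
  combine to the mixed term \<open>re x * tr x\<close>.\<close>

lemma Gamma_eq_tits: "Gamma e \<epsilon> x = tits (re x) (tr x)"
proof -
  have "(x ^ (2 * q) + x ^ 2) * \<epsilon> + x ^ (q + 1) + x ^ 2 = re x * tr x"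
  proof -
    have *: "x ^ (2 * q) = (x ^ q)\<^sup>2" "x ^ (q + 1) = x ^ q * x"
      by (simp_all add: power_mult[symmetric] mult.commute)
    show ?thesis
      unfolding re_def tr_def * by (simp add: algebra_simps power2_eq_square)
  qed
  then show ?thesis
    by (simp add: Gamma_def tits_def re_def tr_def Let_def add_ac flip: q_def)
qed

lemma Gamma_in_Fq [simp]: "Gamma e \<epsilon> x \<in> Fq"
  by (simp add: Gamma_eq_tits)

text \<open>Applying \<sigma> twice is squaring, so the \<sigma>-th power of
  \<open>k ^ (\<sigma> + 1)\<close> is \<open>k ^ (\<sigma> + 2)\<close> and all three terms acquire
  the same factor.\<close>

lemma tits_scale:
  assumes "k \<in> Fq"
  shows "tits (k * a) (k ^ (\<sigma> + 1) * b) = k ^ (\<sigma> + 2) * tits a b"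
proof -
  have "(k ^ (\<sigma> + 1)) ^ \<sigma> = k ^ (\<sigma> + 2)"
  proof -
    have "(k ^ (\<sigma> + 1)) ^ \<sigma> = (k ^ \<sigma>) ^ \<sigma> * k ^ \<sigma>"
      by (simp add: power_add power_mult_distrib)
    then show ?thesis by (simp add: sigma_sigma[OF assms] power_add power2_eq_square mult_ac)
  qed
  then show ?thesis
    by (simp add: tits_def power_mult_distrib power_add power2_eq_square algebra_simps)
qed

text \<open>Scaling reduces a nonzero a to 1. Then \<open>c ^ \<sigma> = 1 + c\<close>, and applying
  \<sigma> again gives \<open>c\<^sup>2 = c\<close>; but neither 0 nor 1 solves the first
  equation.\<close>

lemma tits_eq_0_iff:
  assumes "a \<in> Fq" "b \<in> Fq"
  shows "tits a b = 0 \<longleftrightarrow> a = 0 \<and> b = 0"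
proof
  assume 0: "tits a b = 0"
  have "a = 0"
  proof (rule ccontr)
    assume a: "a \<noteq> 0"
    define c where "c = b / a ^ (\<sigma> + 1)"
    have c: "c \<in> Fq" using assms by (simp add: c_def del: power_Suc)
    have "tits (a * 1) (a ^ (\<sigma> + 1) * c) = a ^ (\<sigma> + 2) * tits 1 c"
      by (rule tits_scale) fact
    then have "tits 1 c = 0" using 0 a by (simp add: c_def)
    then have *: "c ^ \<sigma> = 1 + c" by (simp add: tits_def add_eq_0_iff_eq)
    have "c\<^sup>2 = (1 + c) ^ \<sigma>" using sigma_sigma[OF c] * by simp
    also have "\<dots> = c" by (simp add: power_sigma_add * flip: add.assoc)
    finally have "c = 0 \<or> c = 1" by (simp add: power2_eq_square)
    then show False using * by (auto simp: sigma_exp_def power_0_left)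
  qed
  with 0 show "a = 0 \<and> b = 0" by (simp add: tits_def power_0_left)
qed (simp add: tits_def power_0_left sigma_exp_def)

text \<open>On a finite set injectivity suffices. From \<open>k ^ \<sigma> * k\<^sup>2 = 1\<close>
  applying \<sigma> gives \<open>k\<^sup>2 * (k ^ \<sigma>)\<^sup>2 = 1\<close>; the square of the
  first product is \<open>k\<^sup>2\<close> times the second, so
  \<open>k\<^sup>2 = 1\<close>.\<close>

lemma power_sigma_2_surj:
  assumes "c \<in> Fq" "c \<noteq> 0"
  shows "\<exists>k\<in>Fq - {0}. k ^ (\<sigma> + 2) = c"
proof -
  let ?f = "\<lambda>k::'a. k ^ (\<sigma> + 2)"
  have "inj_on ?f (Fq - {0})"
  proof (rule inj_onI)
    fix x y assume xy: "x \<in> Fq - {0}" "y \<in> Fq - {0}" and eq: "?f x = ?f y"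
    define k where "k = x / y"
    have k: "k \<in> Fq" "k \<noteq> 0" and "k ^ (\<sigma> + 2) = 1"
      using xy eq by (auto simp: k_def power_divide)
    then have 1: "k ^ \<sigma> * k\<^sup>2 = 1" by (simp only: power_add)
    then have "(k ^ \<sigma>) ^ \<sigma> * (k ^ \<sigma>)\<^sup>2 = 1"
      by (metis mult.commute power_mult power_mult_distrib power_one)
    then have 2: "k\<^sup>2 * (k ^ \<sigma>)\<^sup>2 = 1" by (simp add: sigma_sigma[OF k(1)])
    have "k\<^sup>2 * (k ^ \<sigma>)\<^sup>2 * k\<^sup>2 = (k ^ \<sigma> * k\<^sup>2)\<^sup>2" by (simp add: power2_eq_square)
    with 1 2 have "k\<^sup>2 = 1" by simp
    then have "k ^ 2 ^ 1 = 1 ^ 2 ^ 1" by simp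
    then have "k = 1" unfolding frobenius_inj .
    then show "x = y" using xy by (simp add: k_def)
  qed
  moreover have "?f ` (Fq - {0}) \<subseteq> Fq - {0}" by auto
  ultimately have "?f ` (Fq - {0}) = Fq - {0}"
    by (intro endo_inj_surj) auto
  with assms show ?thesis by (metis (no_types, lifting) DiffI image_iff singletonD)
qed

text \<open>Scaling carries the fiber over 1 onto every other nonzero fiber. Their common size s
  satisfies \<open>q ^ 2 = 1 + (q - 1) * s\<close>, which forces s = q + 1.\<close>

lemma card_tits_fiber:
  assumes "c \<in> Fq"
  shows "card {(a, b) \<in> Fq \<times> Fq. tits a b = c} = (if c = 0 then 1 else q + 1)"
proof -
  let ?fib = "\<lambda>c. {(a, b) \<in> Fq \<times> Fq. tits a b = c}"
  have 0: "card (?fib 0) = 1"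
  proof -
    have "?fib 0 = {(0, 0)}" by (auto simp: tits_eq_0_iff)
    then show ?thesis by simp
  qed
  have nz: "card (?fib c) = card (?fib 1)" if c: "c \<in> Fq - {0}" for c
  proof -
    obtain k where k: "k \<in> Fq" "k \<noteq> 0" "k ^ (\<sigma> + 2) = c"
      using power_sigma_2_surj[of c] c by auto
    have kk: "k ^ (\<sigma> + 1) \<in> Fq" using k by blast
    have inv: "tits (a / k) (b / k ^ (\<sigma> + 1)) = tits a b / c" for a b
    proof -
      have "tits (k * (a / k)) (k ^ (\<sigma> + 1) * (b / k ^ (\<sigma> + 1))) = c * tits (a / k) (b / k ^ (\<sigma> + 1))"
        using tits_scale[OF k(1)] k(3) by metis
      then show ?thesis using k c by simp
    qed
    have "bij_betw (\<lambda>(a, b). (k * a, k ^ (\<sigma> + 1) * b)) (?fib 1) (?fib c)"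
    proof (rule bij_betwI[of _ _ _ "\<lambda>(a, b). (a / k, b / k ^ (\<sigma> + 1))"])
      show "(\<lambda>(a, b). (k * a, k ^ (\<sigma> + 1) * b)) \<in> ?fib 1 \<rightarrow> ?fib c"
        using k kk tits_scale[OF k(1)] by (auto simp del: power_Suc simp: k(3))
      show "(\<lambda>(a, b). (a / k, b / k ^ (\<sigma> + 1))) \<in> ?fib c \<rightarrow> ?fib 1"
        using k(1) kk c inv by (auto simp del: power_Suc)
    qed (use k in auto)
    then show ?thesis by (rule bij_betw_same_card[symmetric])
  qed
  have "q ^ 2 = card (Fq \<times> Fq)" by (simp add: card_cartesian_product card_Fq power2_eq_square)
  also have "Fq \<times> Fq = (\<Union>c\<in>Fq. ?fib c)" by auto
  also have "card \<dots> = (\<Sum>c\<in>Fq. card (?fib c))"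
    by (rule card_UN_disjoint) auto
  also have "\<dots> = card (?fib 0) + (\<Sum>c\<in>Fq - {0}. card (?fib c))"
    by (rule sum.remove) auto
  also have "\<dots> = 1 + (q - 1) * card (?fib 1)"
  proof -
    have "(\<Sum>c\<in>Fq - {0}. card (?fib c)) = (\<Sum>c\<in>Fq - {0}. card (?fib 1))"
      by (rule sum.cong[OF refl]) (rule nz)
    then show ?thesis unfolding 0 by (simp add: card_Fq card_Diff_subset)
  qed
  finally have *: "q ^ 2 = 1 + (q - 1) * card (?fib 1)" .
  have "q \<ge> 2" using odd_e by (cases e) (auto simp: q_def)
  then have "q ^ 2 = 1 + (q - 1) * (q + 1)"
    by (simp add: power2_eq_square algebra_simps)
  with * have "(q - 1) * card (?fib 1) = (q - 1) * (q + 1)" by linarith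
  moreover have "q - 1 \<noteq> 0" using \<open>q \<ge> 2\<close> by simp
  ultimately have 1: "card (?fib 1) = q + 1" by (simp only: mult_cancel1) blast
  show ?thesis
  proof (cases "c = 0")
    case True
    then show ?thesis by (simp only: 0) simp
  next
    case False
    then have "card (?fib c) = card (?fib 1)" using assms by (intro nz) simp
    then show ?thesis using False by (simp only: 1 if_False)
  qed
qed

text \<open>Translations of the Suzuki group absorb linear terms: the substitution
  \<open>(a, b) \<mapsto> (a + m, b + t + m\<^sup>\<sigma> a)\<close> changes \<open>tits\<close> by a linear function of \<open>(a, b)\<close> only.\<close>

lemma tits_translate:
  assumes "a \<in> Fq" "b \<in> Fq" "l \<in> Fq" "m \<in> Fq"
  defines "t \<equiv> l + m ^ (\<sigma> + 1)"
  shows "tits (a + m) (b + t + m ^ \<sigma> * a) =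
    tits a b + l * a + m * b + tits m t"
proof -
  have 1: "(b + t + m ^ \<sigma> * a) ^ \<sigma> = b ^ \<sigma> + t ^ \<sigma> + m\<^sup>2 * a ^ \<sigma>"
    by (simp add: power_sigma_add power_mult_distrib sigma_sigma assms)
  have 2: "x ^ (\<sigma> + 2) = x ^ \<sigma> * x\<^sup>2" for x :: 'a by (rule power_add)
  \<comment> \<open>The terms \<open>m\<^sup>2 * a ^ \<sigma>\<close> and
    \<open>m ^ \<sigma> * a\<^sup>2\<close> each occur twice and cancel. The coefficient left at a
    is \<open>t + m ^ (\<sigma> + 1)\<close>; t is chosen to make it l.\<close>
  have 3: "t = l + m * m ^ \<sigma>" by (simp add: t_def)
  show ?thesis
    unfolding tits_def 1 2 power_sigma_add unfolding 3
    using sigma_sigma[OF assms(4)] by (simp add: algebra_simps power2_eq_square)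
qed

text \<open>The linear functional appears when the equation of a plane is solved for the last
  coordinate and inserted into the equation of the variety.\<close>

definition twisted :: "'a \<Rightarrow> 'a \<Rightarrow> 'a" where "twisted \<alpha> x = Gamma e \<epsilon> x + tr (\<alpha> * x)"

lemma twisted_fiber:
  obtains v where "v \<in> Fq"
    "\<And>c. c \<in> Fq \<Longrightarrow> card {x. twisted \<alpha> x = c} = (if c = v then 1 else q + 1)"
proof -
  \<comment> \<open>In coordinates \<open>tr (\<alpha> * x)\<close> is
    \<open>l * re x + m * tr x\<close>. Translation removes it and leaves the constant v, the value
    taken only once.\<close>
  define l m where "l = tr \<alpha>" and "m = tr (\<alpha> * \<epsilon>)"
  define t where "t = l + m ^ (\<sigma> + 1)"
  define v where "v = tits m t"
  have lm [simp]: "l \<in> Fq" "m \<in> Fq" by (auto simp: l_def m_def)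
  then have t [simp]: "t \<in> Fq" unfolding t_def by blast
  have tw: "twisted \<alpha> x = tits (re x + m) (tr x + t + m ^ \<sigma> * re x) + v" for x
  proof -
    have "tr (\<alpha> * x) = tr (re x * \<alpha> + tr x * (\<alpha> * \<epsilon>))"
      by (subst coord[of x, symmetric]) (simp add: algebra_simps)
    also have "\<dots> = l * re x + m * tr x"
      by (simp add: tr_add tr_mult_Fq l_def m_def)
    finally show ?thesis
      using tits_translate[of "re x" "tr x" l m]
      by (simp add: twisted_def Gamma_eq_tits v_def t_def add.assoc)
  qed
  have "card {x. twisted \<alpha> x = c} = (if c = v then 1 else q + 1)" if c: "c \<in> Fq" for c
  proof -
    have vF: "v \<in> Fq" by (simp add: v_def)
    \<comment> \<open>The inverse of the substitution: in characteristic 2 the same terms are added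
      again, with the old \<open>re x\<close> recovered as \<open>a + m\<close>.\<close>
    define g where "g a b = (a + m) + (b + t + m ^ \<sigma> * (a + m)) * \<epsilon>" for a b
    have g: "re (g a b) = a + m" "tr (g a b) = b + t + m ^ \<sigma> * (a + m)"
      if "a \<in> Fq" "b \<in> Fq" for a b
      using that unfolding g_def by (intro re_coord tr_coord; simp)+
    have "bij_betw (\<lambda>x. (re x + m, tr x + t + m ^ \<sigma> * re x)) {x. twisted \<alpha> x = c}
      {(a, b) \<in> Fq \<times> Fq. tits a b = c + v}"
    proof (rule bij_betwI[of _ _ _ "\<lambda>(a, b). g a b"])
      show "(\<lambda>x. (re x + m, tr x + t + m ^ \<sigma> * re x)) \<in> {x. twisted \<alpha> x = c} \<rightarrow>
        {(a, b) \<in> Fq \<times> Fq. tits a b = c + v}"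
        by (auto simp: tw add.assoc)
      show "(\<lambda>(a, b). g a b) \<in>
        {(a, b) \<in> Fq \<times> Fq. tits a b = c + v} \<rightarrow> {x. twisted \<alpha> x = c}"
        by (auto simp: tw g add.assoc)
      show "(case (re x + m, tr x + t + m ^ \<sigma> * re x) of (a, b) \<Rightarrow> g a b) = x" for x
        using coord[of x] by (simp add: g_def algebra_simps)
      show "(\<lambda>x. (re x + m, tr x + t + m ^ \<sigma> * re x)) (case p of (a, b) \<Rightarrow> g a b) = p"
        if "p \<in> {(a, b) \<in> Fq \<times> Fq. tits a b = c + v}" for p
        using that by (auto simp: g add.assoc)
    qed
    then have "card {x. twisted \<alpha> x = c} = card {(a, b) \<in> Fq \<times> Fq. tits a b = c + v}"
      by (rule bij_betw_same_card)
    then show ?thesis using card_tits_fiber[of "c + v"] c vF by (simp add: add_eq_0_iff_eq)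
  qed
  then show ?thesis using that[of v] by (simp add: v_def)
qed

end

section \<open>The equation of the variety\<close>

text \<open>\<open>Gamma\<close> is built from ring operations only, so the homomorphism
  \<open>line_poly v\<close> maps it to the same expression over univariate polynomials.\<close>

lemma line_poly_Gamma:
  "line_poly v (Gamma e (pconst c) (pvar i)) = Gamma e [:c:] (monom (v i) 1)"
  by (simp add: Gamma_def Let_def line_poly_add line_poly_mult line_poly_power line_poly_pvar
      line_poly_pconst)

lemma poly_Gamma_monom: "poly (Gamma e [:c:] (monom x 1)) t = Gamma e c (x * t)"
  by (simp add: Gamma_def Let_def poly_monom mult.commute)

lemma affine_poly_3:
  "affine_poly e 3 c = pvar 3 ^ (2 ^ e) + pvar 3 -
    (Gamma e (pconst c) (pvar 1) + Gamma e (pconst c) (pvar 2))"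
proof -
  have "{1..3 - 1 :: nat} = {1, 2}" by auto
  then show ?thesis by (simp add: affine_poly_def)
qed

lemma total_degree_Gamma_le:
  "total_degree (Gamma e (pconst c) (pvar i)) \<le> 2 ^ e * (sigma_exp e + 2)"
proof -
  let ?q = "2 ^ e :: nat" and ?s = "sigma_exp e" and ?X = "pvar i :: 'a mvpoly"
  have q: "?q \<ge> 1" and s: "?s \<ge> 1" by (simp_all add: sigma_exp_def)
  have X: "total_degree (?X ^ n) \<le> d" if "n \<le> d" for n d
    using that by (intro total_degree_power_le[OF total_degree_pvar_le]) simp
  have c: "total_degree (pconst c) \<le> 0" by (simp add: total_degree_pconst)
  have X1: "total_degree ?X \<le> ?q" using X[of 1 ?q] q by simp
  have Y: "total_degree (?X ^ ?q + ?X) \<le> ?q"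
    by (intro total_degree_add_le X X1) simp
  have "total_degree ((?X ^ ?q + ?X) * pconst c) \<le> ?q"
    using total_degree_mult_le[OF Y c] by simp
  then have Z: "total_degree (?X + (?X ^ ?q + ?X) * pconst c) \<le> ?q"
    by (intro total_degree_add_le X1)
  have 1: "total_degree ((?X + (?X ^ ?q + ?X) * pconst c) ^ (?s + 2)) \<le> ?q * (?s + 2)"
    by (rule total_degree_power_le[OF Z]) simp
  have 2: "total_degree ((?X ^ ?q + ?X) ^ ?s) \<le> ?q * (?s + 2)"
    by (rule total_degree_power_le[OF Y]) simp
  have "2 * ?q \<le> ?q * (?s + 2)" by simp
  moreover have "?q + 1 \<le> ?q * (?s + 2)" "2 \<le> ?q * (?s + 2)"
    using q s mult_le_mono[OF q, of 2 "?s + 2"] by (auto simp: algebra_simps)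
  moreover have "total_degree ((?X ^ (2 * ?q) + ?X ^ 2) * pconst c) \<le> ?q * (?s + 2) + 0"
    using calculation by (intro total_degree_mult_le[OF _ c] total_degree_add_le X)
  ultimately show ?thesis
    unfolding Gamma_def Let_def by (intro total_degree_add_le 1 2 X) simp_all
qed

text \<open>Only the first summand reaches this degree; the term of degree q in its base has
  coefficient \<open>x ^ q * c\<close>. From \<open>e \<ge> 1\<close> comes
  \<open>q \<ge> 2\<close>, which separates that term from the linear one.\<close>

lemma coeff_Gamma:
  fixes x c :: "'a::field"
  assumes "e \<ge> 1"
  shows "coeff (Gamma e [:c:] (monom x 1)) (2 ^ e * (sigma_exp e + 2)) =
    (x ^ 2 ^ e * c) ^ (sigma_exp e + 2)"
proof -
  define q where "q = (2 ^ e :: nat)"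
  define s where "s = sigma_exp e"
  have q: "q \<ge> 2" using assms by (cases e) (auto simp: q_def)
  have s: "s \<ge> 1" by (simp add: s_def sigma_exp_def)
  have mp: "monom x 1 ^ n = monom (x ^ n) n" for n by (simp add: monom_power)
  have c: "degree (p * [:c:]) \<le> degree p" for p
    using degree_mult_le[of p "[:c:]"] by simp
  have X1: "degree (monom x 1) \<le> q" using degree_monom_le[of x 1] q by linarith
  have Y: "degree (monom (x ^ q) q + monom x 1) \<le> q"
    by (intro degree_add_le degree_monom_le X1)
  have Z: "degree (monom x 1 + (monom (x ^ q) q + monom x 1) * [:c:]) \<le> q"
    using c[of "monom (x ^ q) q + monom x 1"] Y by (intro degree_add_le X1) linarith
  have 1: "coeff ((monom x 1 + (monom (x ^ q) q + monom x 1) * [:c:]) ^ (s + 2)) (q * (s + 2)) =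
    (x ^ q * c) ^ (s + 2)"
    unfolding coeff_power_degree_le[OF Z] using q by (simp add: mult.commute)
  have "degree ((monom (x ^ q) q + monom x 1) ^ s) \<le> q * s"
    using degree_power_le[of "monom (x ^ q) q + monom x 1" s] mult_le_mono1[OF Y, of s] by linarith
  then have 2: "coeff ((monom (x ^ q) q + monom x 1) ^ s) (q * (s + 2)) = 0"
    using q by (intro coeff_eq_0) (simp add: algebra_simps)
  have "q * 1 \<le> q * s" by (rule mult_le_mono2[OF s])
  then have 3: "2 * q < q * (s + 2)" "q + 1 < q * (s + 2)" "2 < q * (s + 2)"
    using q by (simp_all add: algebra_simps)
  show ?thesis
    unfolding Gamma_def Let_def q_def[symmetric] s_def[symmetric] mp coeff_add 1 2
    using 3 by (simp add: mult.commute)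
qed

context fq2
begin

lemma e_ge_1: "e \<ge> 1"
  using odd_e by (cases e) auto

lemma eps_nonzero: "\<epsilon> \<noteq> 0"
  using eps_notin by auto

text \<open>The terms in the last variable have degrees q and 1 only, so the top form omits it and
  defines a cone with vertex (0, 0, 0, 1) at infinity.\<close>

lemma coeff_line_affine_poly:
  "coeff (line_poly v (affine_poly e 3 \<epsilon>)) (q * (\<sigma> + 2)) =
    \<epsilon> ^ (\<sigma> + 2) * ((v 1 ^ (\<sigma> + 2)) ^ q + (v 2 ^ (\<sigma> + 2)) ^ q)"
proof -
  have "q \<noteq> q * (\<sigma> + 2)" "1 \<noteq> q * (\<sigma> + 2)"
    using q_gt_0 by (auto simp: algebra_simps simp del: q_gt_0)
  then show ?thesis
    using coeff_Gamma[OF e_ge_1, of \<epsilon>]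
    by (simp add: affine_poly_3 line_poly_diff line_poly_add line_poly_power line_poly_pvar
        line_poly_Gamma monom_power diff_eq_plus minus_eq power_mult_distrib distrib_left
        mult.commute flip: q_def power_mult del: power_Suc)
qed

lemma total_degree_affine_poly: "total_degree (affine_poly e 3 \<epsilon>) = q * (\<sigma> + 2)"
proof (rule antisym)
  have "total_degree (pvar 3 ^ q :: 'a mvpoly) \<le> q * (\<sigma> + 2)"
    by (rule total_degree_power_le[OF total_degree_pvar_le]) simp
  moreover have "total_degree (pvar 3 :: 'a mvpoly) \<le> q * (\<sigma> + 2)"
    by (rule order.trans[OF total_degree_pvar_le]) (simp add: Suc_le_eq)
  ultimately show "total_degree (affine_poly e 3 \<epsilon>) \<le> q * (\<sigma> + 2)"
    unfolding affine_poly_3 q_def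
    by (intro total_degree_diff_le total_degree_add_le total_degree_Gamma_le)
  show "q * (\<sigma> + 2) \<le> total_degree (affine_poly e 3 \<epsilon>)"
  proof (rule total_degree_geI)
    \<comment> \<open>Along the first axis the top coefficient is
      \<open>\<epsilon> ^ (\<sigma> + 2)\<close>.\<close>
    show "coeff (line_poly (\<lambda>i. if i = 1 then 1 else 0) (affine_poly e 3 \<epsilon>)) (q * (\<sigma> + 2)) \<noteq> 0"
      unfolding coeff_line_affine_poly using eps_nonzero by (simp add: power_0_left)
  qed
qed

lemma eval_affine_poly:
  "eval_mvpoly (affine_poly e 3 \<epsilon>) v = tr (v 3) + Gamma e \<epsilon> (v 1) + Gamma e \<epsilon> (v 2)"
  by (simp add: eval_mvpoly_conv_line_poly affine_poly_3 line_poly_diff line_poly_add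
      line_poly_power line_poly_pvar line_poly_Gamma poly_Gamma_monom poly_monom tr_def
      diff_eq_plus add.assoc flip: q_def del: One_nat_def)

text \<open>At infinity the top form is stripped of its nonzero factor
  \<open>\<epsilon> ^ (\<sigma> + 2)\<close> and of the q-th power, which is additive and
  injective.\<close>

definition on_variety :: "(nat \<Rightarrow> 'a) \<Rightarrow> bool"
  where "on_variety v \<longleftrightarrow>
    (if v 0 = 0 then v 1 ^ (\<sigma> + 2) = v 2 ^ (\<sigma> + 2)
     else tr (v 3 / v 0) = Gamma e \<epsilon> (v 1 / v 0) + Gamma e \<epsilon> (v 2 / v 0))"

lemma eval_homogenize_affine_poly:
  "eval_mvpoly (homogenize (affine_poly e 3 \<epsilon>)) v = 0 \<longleftrightarrow> on_variety v"
proof (cases "v 0 = 0")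
  case True
  then show ?thesis
    using eps_nonzero frobenius_inj[of "v 1 ^ (\<sigma> + 2)" e "v 2 ^ (\<sigma> + 2)"]
    unfolding eval_homogenize_infinity[of v, OF True] total_degree_affine_poly coeff_line_affine_poly
    by (simp add: on_variety_def add_eq_0_iff_eq flip: q_def)
next
  case False
  then show ?thesis
    unfolding eval_homogenize_affine[of v, OF False] eval_affine_poly
    by (simp add: on_variety_def add_eq_0_iff_eq add.assoc)
qed

lemma on_variety_scale:
  assumes "c \<noteq> 0" "\<And>i. i \<le> 3 \<Longrightarrow> w i = c * v i" "on_variety v"
  shows "on_variety w"
proof -
  have "w 0 = c * v 0" "w 1 = c * v 1" "w 2 = c * v 2" "w 3 = c * v 3"
    using assms(2) by auto
  then show ?thesis
    using assms(1,3) by (simp add: on_variety_def power_mult_distrib split: if_splits)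
qed

text \<open>With \<open>e = 2 m + 1\<close> we have \<open>\<sigma> + 2 = 2 (2\<^sup>m + 1)\<close>, and
  \<open>gcd(2\<^sup>m + 1, q\<^sup>2 - 1)\<close> divides \<open>3\<close> because \<open>q\<^sup>2 = 4 \<cdot> 2\<close>^\<open>(4 m)\<close>.
  It equals \<open>3\<close> because \<open>e mod 4 = 3\<close> makes \<open>m\<close> odd.\<close>

lemma power_sigma_2_eq_1_iff:
  assumes "e mod 4 = 3"
  shows "w ^ (\<sigma> + 2) = 1 \<longleftrightarrow> w ^ 3 = (1 :: 'a)"
proof
  define m where "m = (e - 1) div 2"
  have e: "e = 2 * m + 1" using odd_e by (auto simp: m_def elim: oddE)
  have \<sigma>: "\<sigma> + 2 = 2 * (2 ^ m + 1)"
    by (simp add: sigma_exp_def e)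
  { have "odd m" using assms e by presburger
    then obtain k where "m = 2 * k + 1" by (auto elim: oddE)
    then have "(2::nat) ^ m + 1 = 2 * 4 ^ k + 1" by (simp add: power_mult)
    also have "\<dots> mod 3 = 0"
      using power_mod[of "4::nat" 3 k] by (simp add: mod_simps)
    finally have "3 dvd \<sigma> + 2" unfolding \<sigma> by (intro dvd_mult) (simp add: mod_eq_0_iff_dvd)
    moreover assume "w ^ 3 = 1"
    ultimately show "w ^ (\<sigma> + 2) = 1" by (auto simp only: dvd_def power_mult power_one) }
  assume "w ^ (\<sigma> + 2) = 1"
  moreover have "(w ^ (2 ^ m + 1)) ^ 2 = w ^ (\<sigma> + 2)"
    unfolding \<sigma> by (simp only: mult.commute[of 2] power_mult)
  ultimately have "(w ^ (2 ^ m + 1)) ^ 2 ^ 1 = 1 ^ 2 ^ 1" by simp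
  then have 1: "w ^ 2 ^ m * w = 1" unfolding frobenius_inj by (simp add: mult.commute)
  then have "w \<noteq> 0" by auto
  \<comment> \<open>Raising to the power \<open>2 ^ m\<close> inverts w, so doing it twice returns
    w. Doing it four times reduces \<open>w ^ (q ^ 2) = w\<close> to
    \<open>w ^ 4 = w\<close>.\<close>
  have "(w ^ 2 ^ m) ^ 2 ^ m * w ^ 2 ^ m = (w ^ 2 ^ m * w) ^ 2 ^ m"
    by (rule power_mult_distrib[symmetric])
  also have "\<dots> = w ^ 2 ^ m * w" by (simp only: 1 power_one)
  finally have "(w ^ 2 ^ m) ^ 2 ^ m * w ^ 2 ^ m = w ^ 2 ^ m * w" .
  with \<open>w \<noteq> 0\<close> have 2: "(w ^ 2 ^ m) ^ 2 ^ m = w" by (simp add: mult.commute)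
  have "q ^ 2 = 2 ^ m * 2 ^ m * (2 ^ m * 2 ^ m) * 4"
    by (simp add: q_def e power_add power2_eq_square mult_2[of m])
  then have "w = w ^ (2 ^ m * 2 ^ m * (2 ^ m * 2 ^ m) * 4)"
    using finite_field_power_card[of w] by (simp add: card_UNIV)
  also have "\<dots> = w ^ 4" unfolding power_mult 2 ..
  finally have "w * w ^ 3 = w * 1" by (simp add: eval_nat_numeral)
  with \<open>w \<noteq> 0\<close> show "w ^ 3 = 1" by (simp only: mult_cancel_left) blast
qed

text \<open>The half trace \<open>y\<close> of \<open>\<delta>\<close> satisfies \<open>y\<^sup>2 + y = \<delta> + Tr \<delta> = \<delta> + 1\<close>,
  so that \<open>\<epsilon> + y\<close> is a primitive third root of unity.\<close>

lemma ex_primitive_cube_root: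
  obtains w :: 'a where "w\<^sup>2 + w = 1"
proof -
  obtain m where m: "e = 2 * m + 1" using odd_e by (auto elim: oddE)
  define y where "y = (\<Sum>i\<le>m. \<delta> ^ 2 ^ (2 * i))"
  \<comment> \<open>The indices 0 to 2n + 1 are sorted by parity. For n = m the extra last term is
    \<open>\<delta> ^ q\<close>, which equals \<delta>.\<close>
  have "(\<Sum>i<Suc (2 * n). \<delta> ^ 2 ^ i) + \<delta> ^ 2 ^ (2 * n + 1) =
      (\<Sum>i\<le>n. \<delta> ^ 2 ^ (2 * i)) + (\<Sum>i\<le>n. \<delta> ^ 2 ^ (2 * i + 1))" for n
    by (induction n) (simp_all add: add_ac)
  from this[of m] have "abs_trace e \<delta> + \<delta> ^ q = y + y\<^sup>2"
    using frobenius_sum[of "\<lambda>i. \<delta> ^ 2 ^ (2 * i)" "{..m}" 1]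
    by (simp add: abs_trace_def m q_def y_def mult.commute flip: power_mult del: sum.lessThan_Suc)
  then have "y + y\<^sup>2 = 1 + \<delta>" using delta_in by (simp add: Fq_iff trace_delta)
  moreover have "\<epsilon>\<^sup>2 + \<epsilon> = \<delta>" using eps_root by (simp add: add_eq_0_iff_eq)
  moreover have "(\<epsilon> + y)\<^sup>2 + (\<epsilon> + y) = (\<epsilon>\<^sup>2 + \<epsilon>) + (y + y\<^sup>2)" by (simp add: square_add add_ac)
  ultimately have "(\<epsilon> + y)\<^sup>2 + (\<epsilon> + y) = 1" by (simp add: add_ac)
  then show ?thesis by (rule that)
qed

text \<open>If \<open>w\<^sup>2 + w = 1\<close>, then T^3 + 1 = (T + 1)(T + w)(T + w + 1) with three
  distinct roots.\<close>

lemma card_cube_roots: "card {w :: 'a. w ^ 3 = 1} = 3"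
proof -
  obtain w :: 'a where w: "w\<^sup>2 + w = 1" by (rule ex_primitive_cube_root)
  have w2: "w * w = w + 1" using w unfolding add_eq_iff by (simp add: power2_eq_square add.commute)
  have "x ^ 3 = 1 \<longleftrightarrow> x = 1 \<or> x = w \<or> x = w + 1" for x
  proof -
    have "(x + 1) * ((x + w) * (x + (w + 1))) = x ^ 3 + 1"
      by (simp add: algebra_simps w2 power3_eq_cube)
    then have "x ^ 3 + 1 = 0 \<longleftrightarrow> x + 1 = 0 \<or> x + w = 0 \<or> x + (w + 1) = 0"
      by (metis mult_eq_0_iff)
    then show ?thesis unfolding add_eq_0_iff_eq .
  qed
  then have "{x. x ^ 3 = 1} = {1, w, w + 1}" by auto
  moreover have "w \<noteq> 1" "w \<noteq> 0" "w + 1 \<noteq> w" using w2 by auto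
  ultimately show ?thesis by auto
qed

end

section \<open>Counting points\<close>

lemma scalar_prod_4:
  assumes "dim_vec u = 4"
  shows "v \<bullet> u = v $ 0 * u $ 0 + v $ 1 * u $ 1 + v $ 2 * u $ 2 + v $ 3 * u $ 3"
proof -
  have "{0..<4::nat} = {0, 1, 2, 3}" by auto
  then show ?thesis using assms by (simp add: scalar_prod_def add.assoc)
qed

text \<open>Every projective point has exactly one coordinate vector with leading entry 1, so
  counting points becomes counting vectors.\<close>

definition normalized_vec :: "'a::field vec \<Rightarrow> bool"
  where "normalized_vec v \<longleftrightarrow> (\<exists>i<dim_vec v. v $ i = 1 \<and> (\<forall>j<i. v $ j = 0))"

lemma proj_point_self: "v \<in> proj_point v"
  unfolding proj_point_def by (rule CollectI, rule exI[of _ 1]) simp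

lemma proj_point_smult:
  assumes "c \<noteq> 0"
  shows "proj_point (c \<cdot>\<^sub>v v) = proj_point (v :: 'a::field vec)"
proof -
  have "\<exists>b. b \<noteq> 0 \<and> a \<cdot>\<^sub>v v = b \<cdot>\<^sub>v (c \<cdot>\<^sub>v v)" if "a \<noteq> 0" for a
    using that assms by (intro exI[of _ "a / c"]) (simp add: smult_smult_assoc)
  moreover have "a \<cdot>\<^sub>v (c \<cdot>\<^sub>v v) = (a * c) \<cdot>\<^sub>v v \<and> a * c \<noteq> 0" if "a \<noteq> 0" for a
    using that assms by (simp add: smult_smult_assoc)
  ultimately show ?thesis unfolding proj_point_def by (auto; metis)
qed

lemma inj_on_proj_point_normalized: "inj_on proj_point {v. normalized_vec v}"
proof (rule inj_onI, clarsimp)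
  fix v w :: "'a vec"
  assume v: "normalized_vec v" and w: "normalized_vec w" and eq: "proj_point v = proj_point w"
  from eq proj_point_self[of w] obtain c where c: "c \<noteq> 0" "w = c \<cdot>\<^sub>v v"
    unfolding proj_point_def by auto
  obtain i where i: "i < dim_vec v" "v $ i = 1" "\<forall>j<i. v $ j = 0"
    using v by (auto simp: normalized_vec_def)
  obtain k where k: "k < dim_vec v" "c * v $ k = 1" "\<forall>j<k. c * v $ j = 0"
    using w c(2) by (auto simp: normalized_vec_def)
  have "i = k" using i k c(1) by (metis linorder_neqE_nat mult_zero_right mult_eq_0_iff zero_neq_one)
  then show "v = w" using i k c(2) by simp
qed

lemma PG_normalized: "PG r = proj_point ` {v \<in> carrier_vec (r + 1). normalized_vec v}"
proof (intro equalityI subsetI)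
  fix P :: "'a vec set" assume "P \<in> PG r"
  then obtain v where v: "v \<in> carrier_vec (r + 1)" "v \<noteq> 0\<^sub>v (r + 1)" "P = proj_point v"
    by (auto simp: PG_def)
  then have ex: "\<exists>i. i < r + 1 \<and> v $ i \<noteq> 0"
    by (metis carrier_vecD eq_vecI index_zero_vec)
  define i where "i = (LEAST i. i < r + 1 \<and> v $ i \<noteq> 0)"
  have i: "i < r + 1" "v $ i \<noteq> 0" using LeastI_ex[OF ex] by (auto simp: i_def)
  have less: "v $ j = 0" if "j < i" for j
    using not_less_Least[of j "\<lambda>i. i < r + 1 \<and> v $ i \<noteq> 0"] that i(1) by (auto simp: i_def)
  let ?w = "inverse (v $ i) \<cdot>\<^sub>v v"
  have "normalized_vec ?w" unfolding normalized_vec_def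
    by (rule exI[of _ i]) (use i less v(1) in auto)
  moreover have "P = proj_point ?w" using v(3) i(2) by (simp add: proj_point_smult)
  ultimately show "P \<in> proj_point ` {v \<in> carrier_vec (r + 1). normalized_vec v}"
    using v(1) by auto
next
  fix P :: "'a vec set" assume "P \<in> proj_point ` {v \<in> carrier_vec (r + 1). normalized_vec v}"
  then obtain v where v: "v \<in> carrier_vec (r + 1)" "normalized_vec v" "P = proj_point v" by auto
  then have "v \<noteq> 0\<^sub>v (r + 1)" by (auto simp: normalized_vec_def)
  with v show "P \<in> PG r" by (auto simp: PG_def)
qed

text \<open>A codeword lists the values of one linear form u on the columns; its zero positions are
  the points on the hyperplane of u.\<close>

lemma lin_codeE:
  assumes "c \<in> lin_code G" "G \<in> carrier_mat n k"
  obtains u where "u \<in> carrier_vec n" "dim_vec c = k" "\<And>j. j < k \<Longrightarrow> c $ j = col G j \<bullet> u"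
proof -
  from assms obtain u where u: "u \<in> carrier_vec n" "c = G\<^sup>T *\<^sub>v u" "c \<in> carrier_vec k"
    using vec_space.row_space_eq[of G n k] unfolding lin_code_def by auto
  show ?thesis
    by (rule that[OF u(1)]) (use u assms in auto)
qed

lemma bij_betw_Collect_image:
  assumes "bij_betw f A B"
  shows "bij_betw f {a \<in> A. P (f a)} {b \<in> B. P b}"
  by (rule bij_betw_subset[OF assms]) (use assms in \<open>auto simp: bij_betw_def\<close>)

text \<open>Whether a linear form vanishes at a point is independent of the coordinate vector.
  Columns can be exchanged for normalized vectors, and the choice of G drops out.\<close>

lemma hamming_weight_eq_card:
  assumes G: "generates_code_of r (proj_point ` R) G"
    and R: "R \<subseteq> {v \<in> carrier_vec (r + 1). normalized_vec v}"
    and u: "u \<in> carrier_vec (r + 1)"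
    and c: "dim_vec c = card (proj_point ` R)"
      "\<And>j. j < card (proj_point ` R) \<Longrightarrow> c $ j = col G j \<bullet> u"
  shows "hamming_weight c = card {v \<in> R. v \<bullet> u \<noteq> 0}"
proof -
  let ?n = "card (proj_point ` R)"
  have G': "G \<in> carrier_mat (r + 1) ?n"
    and bij: "bij_betw (\<lambda>j. proj_point (col G j)) {..<?n} (proj_point ` R)"
    using G by (auto simp: generates_code_of_def)
  let ?off = "\<lambda>P. \<exists>v\<in>P. v \<bullet> u \<noteq> 0"
  have off: "?off (proj_point v) \<longleftrightarrow> v \<bullet> u \<noteq> 0" if "v \<in> carrier_vec (r + 1)" for v
  proof -
    have "(a \<cdot>\<^sub>v v) \<bullet> u = a * (v \<bullet> u)" for a
      using smult_scalar_prod_distrib[OF that u] .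
    then show ?thesis using proj_point_self[of v] by (auto simp: proj_point_def)
  qed
  have "card {j \<in> {..<?n}. ?off (proj_point (col G j))} = card {P \<in> proj_point ` R. ?off P}"
    by (rule bij_betw_same_card[OF bij_betw_Collect_image[OF bij]])
  moreover have "{i. i < dim_vec c \<and> c $ i \<noteq> 0} = {j \<in> {..<?n}. ?off (proj_point (col G j))}"
  proof -
    have "?off (proj_point (col G j)) \<longleftrightarrow> c $ j \<noteq> 0" if "j < ?n" for j
      using off[of "col G j"] c(2)[OF that] G' that by (simp add: col_carrier_vec)
    then show ?thesis using c(1) by auto
  qed
  moreover have "{P \<in> proj_point ` R. ?off P} = proj_point ` {v \<in> R. v \<bullet> u \<noteq> 0}"
    using off R by blast
  moreover have "card (proj_point ` {v \<in> R. v \<bullet> u \<noteq> 0}) = card {v \<in> R. v \<bullet> u \<noteq> 0}"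
    by (rule card_image) (rule inj_on_subset[OF inj_on_proj_point_normalized], use R in blast)
  ultimately show ?thesis by (simp add: hamming_weight_def)
qed

lemma card_Collect_neg_add: "card {x \<in> A. \<not> P x} + card {x \<in> A. P x} = card A" if "finite A"
  using card_Un_disjoint[of "{x \<in> A. \<not> P x}" "{x \<in> A. P x}"] that
  by (subst card_Un_disjoint[symmetric]) (auto intro!: arg_cong[where f = card])

section \<open>Plane sections of the affine part\<close>

context fq2
begin

lemma card_plane:
  assumes "u2 \<noteq> (0 :: 'a)"
  shows "card {p. u0 + u1 * fst p + u2 * snd p = 0} = q\<^sup>2"
    "card {p. u0 + u1 * snd p + u2 * fst p = 0} = q\<^sup>2"
proof -
  have *: "u0 + u1 * x + u2 * y = 0 \<longleftrightarrow> y = (u0 + u1 * x) / u2" for x y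
    using assms by (auto simp: add_eq_0_iff_eq field_simps)
  have "bij_betw (\<lambda>x. (x, (u0 + u1 * x) / u2)) UNIV {p. u0 + u1 * fst p + u2 * snd p = 0}"
    by (rule bij_betwI[of _ _ _ fst]) (auto simp: *)
  from bij_betw_same_card[OF this] show "card {p. u0 + u1 * fst p + u2 * snd p = 0} = q\<^sup>2"
    by (simp add: card_UNIV)
  have "bij_betw (\<lambda>x. ((u0 + u1 * x) / u2, x)) UNIV {p. u0 + u1 * snd p + u2 * fst p = 0}"
    by (rule bij_betwI[of _ _ _ snd]) (auto simp: *)
  from bij_betw_same_card[OF this] show "card {p. u0 + u1 * snd p + u2 * fst p = 0} = q\<^sup>2"
    by (simp add: card_UNIV)
qed

definition affine_points :: "(('a \<times> 'a) \<times> 'a) set"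
  where "affine_points = (SIGMA p:UNIV. {z. tr z = Gamma e \<epsilon> (fst p) + Gamma e \<epsilon> (snd p)})"

text \<open>\<open>Gamma\<close> has values in \<open>Fq\<close>, over which every fiber of
  \<open>tr\<close> has q elements.\<close>

lemma card_cylinder:
  "card (SIGMA p:B. {z. tr z = Gamma e \<epsilon> (fst p) + Gamma e \<epsilon> (snd p)}) = card B * q"
  by (subst card_SigmaI) (auto simp: card_tr_fiber)

lemma card_affine_points: "card affine_points = q ^ 5"
proof -
  have "card (UNIV :: ('a \<times> 'a) set) = q ^ 4"
    using card_cartesian_product[of "UNIV :: 'a set" "UNIV :: 'a set"]
    by (simp add: card_UNIV flip: power_add)
  then show ?thesis unfolding affine_points_def card_cylinder by (simp add: eval_nat_numeral)
qed

definition hyperplane_form :: "'a \<Rightarrow> 'a \<Rightarrow> 'a \<Rightarrow> 'a \<Rightarrow> ('a \<times> 'a) \<times> 'a \<Rightarrow> 'a"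
  where "hyperplane_form u0 u1 u2 u3 p = u0 + u1 * fst (fst p) + u2 * snd (fst p) + u3 * snd p"

text \<open>A form without the last variable cuts out the cylinder over an affine line with
  \<open>q\<^sup>2\<close> points.\<close>

lemma card_affine_section_vertical:
  assumes "u1 \<noteq> 0 \<or> u2 \<noteq> 0"
  shows "card {p \<in> affine_points. hyperplane_form u0 u1 u2 0 p = 0} = q ^ 3"
proof -
  have "{p \<in> affine_points. hyperplane_form u0 u1 u2 0 p = 0} =
      (SIGMA p:{p. u0 + u1 * fst p + u2 * snd p = 0}.
        {z. tr z = Gamma e \<epsilon> (fst p) + Gamma e \<epsilon> (snd p)})"
    by (auto simp: affine_points_def hyperplane_form_def)
  moreover have "card {p. u0 + u1 * fst p + u2 * snd p = 0} = q\<^sup>2"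
    using card_plane(1)[of u2 u0 u1] card_plane(2)[of u1 u0 u2] assms
    by (auto simp: add.commute add.left_commute)
  ultimately show ?thesis by (simp add: card_cylinder eval_nat_numeral)
qed

text \<open>Convolving the fiber sizes \<open>1\<close> (once) and \<open>q + 1\<close> (otherwise) of the two
  functions \<open>twisted \<alpha>\<close> and \<open>twisted \<beta>\<close>: everything depends on whether their
  exceptional values add up to \<open>c\<close>.\<close>

lemma card_twisted_sum:
  assumes "c \<in> Fq"
  shows "int (card {p. twisted \<alpha> (fst p) + twisted \<beta> (snd p) = c}) \<in>
    {int q ^ 3 - int q, int q ^ 3 + int q ^ 2 - int q}"
proof -
  obtain v where v: "v \<in> Fq"
    "\<And>d. d \<in> Fq \<Longrightarrow> card {x. twisted \<beta> x = d} = (if d = v then 1 else q + 1)"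
    by (rule twisted_fiber[of \<beta>]) blast
  obtain v' where v': "v' \<in> Fq"
    "\<And>d. d \<in> Fq \<Longrightarrow> card {x. twisted \<alpha> x = d} = (if d = v' then 1 else q + 1)"
    by (rule twisted_fiber[of \<alpha>]) blast
  \<comment> \<open>The x that leave only one y. As a fiber of \<open>twisted \<alpha>\<close>, N
    has size 1 or q + 1, which gives the larger or the smaller total.\<close>
  define N where "N = {x. twisted \<alpha> x = c + v}"
  have tw: "twisted \<alpha> x \<in> Fq" for x by (simp add: twisted_def)
  have "{p. twisted \<alpha> (fst p) + twisted \<beta> (snd p) = c} =
      (SIGMA x:UNIV. {y. twisted \<beta> y = c + twisted \<alpha> x})"
    using add_eq_iff by (auto simp: add.commute)
  then have "card {p. twisted \<alpha> (fst p) + twisted \<beta> (snd p) = c} =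
      (\<Sum>x\<in>UNIV. card {y. twisted \<beta> y = c + twisted \<alpha> x})"
    by (simp add: card_SigmaI)
  also have "\<dots> = (\<Sum>x\<in>UNIV. if x \<in> N then 1 else q + 1)"
  proof (rule sum.cong[OF refl])
    fix x
    have "c + twisted \<alpha> x = v \<longleftrightarrow> x \<in> N"
      using add_eq_iff[of "twisted \<alpha> x" c v] by (simp add: N_def add.commute)
    then show "card {y. twisted \<beta> y = c + twisted \<alpha> x} = (if x \<in> N then 1 else q + 1)"
      using v(2)[of "c + twisted \<alpha> x"] assms tw[of x] by simp
  qed
  also have "\<dots> = card N + card (- N) * (q + 1)"
    by (subst sum.If_cases) (auto simp: mult.commute)
  also have "card (- N) = q\<^sup>2 - card N"
    by (simp add: Compl_eq_Diff_UNIV card_Diff_subset card_UNIV)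
  finally have *: "card {p. twisted \<alpha> (fst p) + twisted \<beta> (snd p) = c} =
    card N + (q\<^sup>2 - card N) * (q + 1)" .
  \<comment> \<open>With this bound the truncated subtraction passes to \<open>int\<close>
    unchanged.\<close>
  have "card N \<le> q\<^sup>2" using card_mono[of UNIV N] by (simp add: card_UNIV)
  then have "int (card {p. twisted \<alpha> (fst p) + twisted \<beta> (snd p) = c}) =
    int (card N) + (int q ^ 2 - int (card N)) * (int q + 1)"
    unfolding * by (simp only: of_nat_add of_nat_mult of_nat_diff of_nat_power of_nat_1)
  moreover have "card N = 1 \<or> card N = q + 1"
    using v'(2)[of "c + v"] v(1) assms by (auto simp: N_def)
  ultimately show ?thesis by (auto simp: power3_eq_cube power2_eq_square algebra_simps)
qed

text \<open>Solving for the last coordinate splits its trace into the constant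
  \<open>tr (u0 / u3)\<close> and two functionals absorbed by \<open>twisted\<close>; the section is
  a level set of a sum of two such functions.\<close>

lemma card_affine_section_transversal:
  assumes "u3 \<noteq> 0"
  shows "int (card {p \<in> affine_points. hyperplane_form u0 u1 u2 u3 p = 0}) \<in>
    {int q ^ 3 - int q, int q ^ 3 + int q ^ 2 - int q}"
proof -
  define z where "z p = u0 / u3 + u1 / u3 * fst p + u2 / u3 * snd p" for p
  let ?S = "{p. twisted (u1 / u3) (fst p) + twisted (u2 / u3) (snd p) = tr (u0 / u3)}"
  let ?T = "{p \<in> affine_points. hyperplane_form u0 u1 u2 u3 p = 0}"
  have form: "hyperplane_form u0 u1 u2 u3 x = 0 \<longleftrightarrow> snd x = z (fst x)" for x
  proof -
    have "hyperplane_form u0 u1 u2 u3 x = u3 * (z (fst x) + snd x)"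
      using assms by (simp add: hyperplane_form_def z_def field_simps)
    then show ?thesis using assms by (auto simp: add_eq_0_iff_eq)
  qed
  have mem: "(p, z p) \<in> affine_points \<longleftrightarrow> p \<in> ?S" for p
  proof -
    have "(p, z p) \<in> affine_points \<longleftrightarrow>
        tr (u0 / u3) + tr (u1 / u3 * fst p) + tr (u2 / u3 * snd p) =
        Gamma e \<epsilon> (fst p) + Gamma e \<epsilon> (snd p)"
      by (simp add: affine_points_def tr_add z_def)
    also have "\<dots> \<longleftrightarrow> p \<in> ?S"
      unfolding add_eq_iff twisted_def by (auto simp: add_ac)
    finally show ?thesis .
  qed
  have "bij_betw (\<lambda>p. (p, z p)) ?S ?T"
  proof (rule bij_betwI[of _ _ _ fst])
    show "(\<lambda>p. (p, z p)) \<in> ?S \<rightarrow> ?T"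
      using mem by (intro funcsetI CollectI conjI) (auto simp: form)
    show "fst \<in> ?T \<rightarrow> ?S"
    proof
      fix x assume "x \<in> ?T"
      then have "x \<in> affine_points" "x = (fst x, z (fst x))"
        by (auto simp: form prod_eq_iff)
      then show "fst x \<in> ?S" using mem[of "fst x"] by simp
    qed
  qed (auto simp: form prod_eq_iff)
  then have "card ?T = card ?S" by (rule bij_betw_same_card[symmetric])
  then show ?thesis using card_twisted_sum[of "tr (u0 / u3)"] by simp
qed

end

section \<open>Points of the variety and weights of codewords\<close>

definition vec4 :: "'a \<Rightarrow> 'a \<Rightarrow> 'a \<Rightarrow> 'a \<Rightarrow> 'a vec"
  where "vec4 a b c d = vec 4 ((!) [a, b, c, d])"

lemma vec4_simps [simp]:
  "vec4 a b c d \<in> carrier_vec 4" "dim_vec (vec4 a b c d) = 4"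
  "vec4 a b c d $ 0 = a" "vec4 a b c d $ 1 = b" "vec4 a b c d $ Suc 0 = b"
  "vec4 a b c d $ 2 = c" "vec4 a b c d $ 3 = d"
  by (simp_all add: vec4_def)

lemma less_4_iff: "i < (4::nat) \<longleftrightarrow> i = 0 \<or> i = 1 \<or> i = 2 \<or> i = 3"
  by auto

lemma vec4_eta:
  assumes "v \<in> carrier_vec 4"
  shows "vec4 (v $ 0) (v $ 1) (v $ 2) (v $ 3) = v"
  by (rule eq_vecI) (use assms in \<open>auto simp: less_4_iff\<close>)

lemma normalized_vec_4:
  assumes "v \<in> carrier_vec 4"
  shows "normalized_vec v \<longleftrightarrow> v $ 0 = 1 \<or> v $ 0 = 0 \<and> (v $ 1 = 1 \<or>
    v $ 1 = 0 \<and> (v $ 2 = 1 \<or> v $ 2 = 0 \<and> v $ 3 = 1))"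
proof -
  have all: "(\<forall>j<1. P j) \<longleftrightarrow> P 0" "(\<forall>j<2. P j) \<longleftrightarrow> P 0 \<and> P 1"
    "(\<forall>j<3. P j) \<longleftrightarrow> P 0 \<and> P 1 \<and> P 2" for P :: "nat \<Rightarrow> bool"
    by (auto simp: numeral_eq_Suc less_Suc_eq)
  have ex: "(\<exists>i<4. P i) \<longleftrightarrow> P 0 \<or> P 1 \<or> P 2 \<or> P 3" for P :: "nat \<Rightarrow> bool"
    unfolding less_4_iff by blast
  show ?thesis
    unfolding normalized_vec_def carrier_vecD[OF assms] ex all by blast
qed

context fq2
begin

definition normalized_points :: "'a vec set"
  where "normalized_points =
    {v \<in> carrier_vec 4. normalized_vec v \<and> on_variety (\<lambda>i. v $ i)}"

lemma variety_eq: "variety e 3 \<epsilon> = proj_point ` normalized_points"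
proof -
  have "(\<forall>w\<in>proj_point v. on_variety (\<lambda>i. w $ i)) \<longleftrightarrow> on_variety (\<lambda>i. v $ i)"
    if "v \<in> carrier_vec 4" for v
  proof
    assume v: "on_variety (\<lambda>i. v $ i)"
    show "\<forall>w\<in>proj_point v. on_variety (\<lambda>i. w $ i)"
    proof
      fix w assume "w \<in> proj_point v"
      then obtain c where "c \<noteq> 0" "w = c \<cdot>\<^sub>v v" by (auto simp: proj_point_def)
      with that v show "on_variety (\<lambda>i. w $ i)"
        by (intro on_variety_scale[of c "\<lambda>i. w $ i" "\<lambda>i. v $ i"]) auto
    qed
  qed (use proj_point_self in blast)
  then show ?thesis
    unfolding variety_def proj_zero_locus_def eval_homogenize_affine_poly PG_normalized
      normalized_points_def by auto
qed

text \<open>Points are sorted by their leading coordinate: affine points; points of the three lines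
  at infinity without their vertex, where \<open>v $ 2\<close> is a cube root of 1 and
  \<open>v $ 3\<close> is free; and the vertex (0, 0, 0, 1), which lies off the plane unless
  \<open>u $ 3 = 0\<close>.\<close>

lemma card_points_off_hyperplane:
  assumes "e mod 4 = 3" "u \<in> carrier_vec 4"
  shows "card {v \<in> normalized_points. v \<bullet> u \<noteq> 0} =
    card {p \<in> affine_points. hyperplane_form (u $ 0) (u $ 1) (u $ 2) (u $ 3) p \<noteq> 0} +
    card {p \<in> {w. w ^ 3 = 1} \<times> UNIV. u $ 1 + u $ 2 * fst p + u $ 3 * snd p \<noteq> 0} +
    (if u $ 3 = 0 then 0 else 1)" (is "card ?W = card ?A + card ?B + ?c")
proof -
  let ?Q = "\<lambda>v. v \<in> normalized_points \<and> v \<bullet> u \<noteq> 0"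
  let ?Aff = "{v. ?Q v \<and> v $ 0 = 1}" and ?Line = "{v. ?Q v \<and> v $ 0 = 0 \<and> v $ 1 = 1}"
    and ?Apex = "{v. ?Q v \<and> v $ 0 = 0 \<and> v $ 1 = 0}"
  have dot: "v \<bullet> u = v $ 0 * u $ 0 + v $ 1 * u $ 1 + v $ 2 * u $ 2 + v $ 3 * u $ 3" for v
    using assms(2) by (intro scalar_prod_4) auto
  have carrier: "v \<in> carrier_vec 4" if "v \<in> normalized_points" for v
    using that by (simp add: normalized_points_def)
  have mem: "v \<in> normalized_points \<longleftrightarrow> on_variety (\<lambda>i. v $ i) \<and>
    (v $ 0 = 1 \<or> v $ 0 = 0 \<and> (v $ 1 = 1 \<or>
    v $ 1 = 0 \<and> (v $ 2 = 1 \<or> v $ 2 = 0 \<and> v $ 3 = 1)))" if "v \<in> carrier_vec 4" for v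
    using that normalized_vec_4[OF that] by (auto simp: normalized_points_def)
  have on: "on_variety (\<lambda>i. v $ i)" if "v \<in> normalized_points" for v
    using that by (simp add: normalized_points_def)
  have fin: "finite ?W"
  proof (rule finite_subset)
    show "?W \<subseteq> (\<lambda>(a, b, c, d). vec4 a b c d) ` UNIV"
    proof
      fix v assume "v \<in> ?W"
      then have "v = (\<lambda>(a, b, c, d). vec4 a b c d) (v $ 0, v $ 1, v $ 2, v $ 3)"
        using vec4_eta[OF carrier, of v] by simp
      then show "v \<in> (\<lambda>(a, b, c, d). vec4 a b c d) ` UNIV" by (rule image_eqI) simp
    qed
  qed simp
  have "v $ 0 = 1 \<or> v $ 0 = 0 \<and> (v $ 1 = 1 \<or> v $ 1 = 0)" if "v \<in> normalized_points" for v
    using that mem[OF carrier[OF that]] by blast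
  then have W: "?W = (?Aff \<union> ?Line) \<union> ?Apex" by blast
  have fins: "finite ?Aff" "finite ?Line" "finite ?Apex"
    by (rule finite_subset[OF _ fin], blast)+
  have "card ?W = card (?Aff \<union> ?Line) + card ?Apex"
    unfolding W by (rule card_Un_disjoint) (use fins in \<open>auto simp del: One_nat_def\<close>)
  also have "card (?Aff \<union> ?Line) = card ?Aff + card ?Line"
    by (rule card_Un_disjoint) (use fins in auto)
  finally have "card ?W = card ?Aff + card ?Line + card ?Apex" .
  moreover have "card ?Aff = card ?A"
  proof (rule bij_betw_same_card)
    show "bij_betw (\<lambda>v. ((v $ 1, v $ 2), v $ 3)) ?Aff ?A"
    proof (rule bij_betwI[of _ _ _ "\<lambda>((a, b), c). vec4 1 a b c"])
      show "(\<lambda>v. ((v $ 1, v $ 2), v $ 3)) \<in> ?Aff \<rightarrow> ?A"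
        by (auto dest!: on simp: dot on_variety_def affine_points_def hyperplane_form_def
            mult.commute)
      show "(\<lambda>((a, b), c). vec4 1 a b c) \<in> ?A \<rightarrow> ?Aff"
        by (auto simp: mem dot on_variety_def affine_points_def hyperplane_form_def mult.commute)
      show "(\<lambda>((a, b), c). vec4 1 a b c) ((v $ 1, v $ 2), v $ 3) = v" if "v \<in> ?Aff" for v
        using that vec4_eta[OF carrier, of v] by auto
    qed auto
  qed
  moreover have "card ?Line = card ?B"
  proof (rule bij_betw_same_card)
    have cube: "1 ^ (\<sigma> + 2) = w ^ (\<sigma> + 2) \<longleftrightarrow> w ^ 3 = 1" for w :: 'a
      using power_sigma_2_eq_1_iff[OF assms(1), of w] by (metis power_one)
    have line1: "(v $ 2) ^ 3 = 1" if "v \<in> normalized_points" "v $ 0 = 0" "v $ 1 = 1" for v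
      using on[OF that(1)] cube[of "v $ 2"] that(2,3) unfolding on_variety_def by metis
    have line2: "vec4 0 1 b c \<in> normalized_points \<longleftrightarrow> b ^ 3 = 1" for b c
      using cube[of b] by (simp add: mem on_variety_def)
    show "bij_betw (\<lambda>v. (v $ 2, v $ 3)) ?Line ?B"
    proof (rule bij_betwI[of _ _ _ "\<lambda>(b, c). vec4 0 1 b c"])
      show "(\<lambda>v. (v $ 2, v $ 3)) \<in> ?Line \<rightarrow> ?B"
        using line1 by (auto simp: dot mult.commute)
      show "(\<lambda>(b, c). vec4 0 1 b c) \<in> ?B \<rightarrow> ?Line"
        by (auto simp: line2 dot mult.commute)
      show "(\<lambda>(b, c). vec4 0 1 b c) (v $ 2, v $ 3) = v" if "v \<in> ?Line" for v
        using that vec4_eta[OF carrier, of v] by auto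
    qed auto
  qed
  moreover have "?Apex = (if u $ 3 = 0 then {} else {vec4 0 0 0 1})"
  proof -
    have "v = vec4 0 0 0 1 \<and> u $ 3 \<noteq> 0" if "v \<in> ?Apex" for v
    proof -
      have v: "v \<in> carrier_vec 4" using that carrier by auto
      \<comment> \<open>With the first two coordinates 0, the equation at infinity forces
        \<open>v $ 2 = 0\<close>.\<close>
      then have "v $ 2 = 0 \<and> v $ 3 = 1" using that mem[OF v]
        by (auto simp: on_variety_def power_0_left)
      then show ?thesis using that vec4_eta[OF v] by (auto simp: dot)
    qed
    moreover have "vec4 0 0 0 1 \<in> ?Apex" if "u $ 3 \<noteq> 0"
      using that by (auto simp: mem dot on_variety_def)
    ultimately show ?thesis by (auto split: if_splits)
  qed
  then have "card ?Apex = ?c" by simp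
  ultimately show ?thesis by linarith
qed

text \<open>A plane off the vertex meets each of the three lines once. A plane through it, other
  than the one at infinity, contains at most one of them and meets the others in the vertex
  only.\<close>

lemma card_infinite_section:
  defines "K \<equiv> {w :: 'a. w ^ 3 = 1}"
  defines "Z u1 u2 u3 \<equiv> {p \<in> K \<times> UNIV. u1 + u2 * fst p + u3 * snd p = 0}"
  shows "u3 \<noteq> 0 \<Longrightarrow> card (Z u1 u2 u3) = 3"
    and "u1 \<noteq> 0 \<or> u2 \<noteq> 0 \<Longrightarrow> card (Z u1 u2 0) \<in> {0, q\<^sup>2}"
proof -
  assume u3: "u3 \<noteq> 0"
  have "bij_betw (\<lambda>w. (w, (u1 + u2 * w) / u3)) K (Z u1 u2 u3)"
    by (rule bij_betwI[of _ _ _ fst])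
       (use u3 in \<open>auto simp: Z_def add_eq_0_iff_eq field_simps\<close>)
  then show "card (Z u1 u2 u3) = 3"
    using bij_betw_same_card[of _ K] card_cube_roots by (metis K_def)
next
  assume "u1 \<noteq> 0 \<or> u2 \<noteq> 0"
  have "Z u1 u2 0 = {w \<in> K. u1 + u2 * w = 0} \<times> UNIV" by (auto simp: Z_def)
  then have "card (Z u1 u2 0) = card {w \<in> K. u1 + u2 * w = 0} * q\<^sup>2"
    by (simp add: card_cartesian_product card_UNIV)
  \<comment> \<open>For \<open>u2 = 0\<close> the left side is empty since u1 is nonzero, so the
    default \<open>u1 / 0 = 0\<close> does no harm.\<close>
  moreover have "{w \<in> K. u1 + u2 * w = 0} \<subseteq> {u1 / u2}"
    using \<open>u1 \<noteq> 0 \<or> u2 \<noteq> 0\<close> by (auto simp: add_eq_0_iff_eq field_simps)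
  then have "card {w \<in> K. u1 + u2 * w = 0} \<le> 1"
    by (metis card_mono card_1_singleton_iff finite.emptyI finite_insert One_nat_def)
  ultimately show "card (Z u1 u2 0) \<in> {0, q\<^sup>2}"
    by (cases "card {w \<in> K. u1 + u2 * w = 0}") auto
qed

text \<open>Planes off the vertex have b = 3 and gain 1 from the vertex, hence the two values ending
  in q - 2. Planes through it have a = \<open>q ^ 3\<close> and b in {0, \<open>q\<^sup>2\<close>};
  the plane at infinity leaves all \<open>q ^ 5\<close> affine points.\<close>

lemma weight_cases:
  assumes "e mod 4 = 3" "u \<in> carrier_vec 4" "u \<noteq> 0\<^sub>v 4"
  shows "int (card {v \<in> normalized_points. v \<bullet> u \<noteq> 0}) \<in>
    {int q ^ 5,
     int q ^ 5 - int q ^ 3 + 3 * int q ^ 2,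
     int q ^ 5 - int q ^ 3 + 2 * int q ^ 2,
     int q ^ 5 - int q ^ 3 + 3 * int q ^ 2 + int q - 2,
     int q ^ 5 - int q ^ 3 + 2 * int q ^ 2 + int q - 2}"
proof -
  let ?f = "hyperplane_form (u $ 0) (u $ 1) (u $ 2) (u $ 3)"
  let ?K = "{w :: 'a. w ^ 3 = 1}"
  let ?g = "\<lambda>p. u $ 1 + u $ 2 * fst p + u $ 3 * snd p"
  define a where "a = card {p \<in> affine_points. ?f p = 0}"
  define b where "b = card {p \<in> ?K \<times> UNIV. ?g p = 0}"
  have 1: "int (card {p \<in> affine_points. ?f p \<noteq> 0}) = int q ^ 5 - int a"
    using card_Collect_neg_add[of affine_points "\<lambda>p. ?f p = 0"]
    unfolding card_affine_points a_def by (simp flip: of_nat_power)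
  have "card (?K \<times> (UNIV :: 'a set)) = 3 * q\<^sup>2"
    by (simp add: card_cartesian_product card_cube_roots card_UNIV)
  then have 2: "int (card {p \<in> ?K \<times> UNIV. ?g p \<noteq> 0}) = 3 * int q ^ 2 - int b"
    using card_Collect_neg_add[of "?K \<times> UNIV" "\<lambda>p. ?g p = 0"]
    unfolding b_def by (simp flip: of_nat_power)
  have *: "int (card {v \<in> normalized_points. v \<bullet> u \<noteq> 0}) =
    int q ^ 5 - int a + (3 * int q ^ 2 - int b) + (if u $ 3 = 0 then 0 else 1)"
    unfolding card_points_off_hyperplane[OF assms(1,2)] of_nat_add 1 2 by simp
  show ?thesis
  proof (cases "u $ 3 = 0")
    case False
    then have "b = 3" unfolding b_def by (rule card_infinite_section(1))
    with card_affine_section_transversal[OF False, of "u $ 0" "u $ 1" "u $ 2"] False show ?thesis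
      unfolding * a_def[symmetric] by auto
  next
    case True
    show ?thesis
    proof (cases "u $ 1 = 0 \<and> u $ 2 = 0")
      case False
      then have "a = q ^ 3" unfolding a_def True by (intro card_affine_section_vertical) auto
      moreover have "b \<in> {0, q\<^sup>2}"
        unfolding b_def True using False by (intro card_infinite_section(2)) auto
      ultimately show ?thesis unfolding * using True by auto
    next
      case zero: True
      have "u $ 0 \<noteq> 0"
      proof
        assume "u $ 0 = 0"
        then have "u = 0\<^sub>v 4"
          using assms(2) zero True by (intro eq_vecI) (auto simp: less_4_iff)
        with assms(3) show False by simp
      qed
      then have "a = 0" unfolding a_def using True zero by (simp add: hyperplane_form_def)
      moreover have "{p \<in> ?K \<times> UNIV. ?g p = 0} = ?K \<times> (UNIV :: 'a set)"
        using True zero by auto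
      then have "b = 3 * q\<^sup>2"
        unfolding b_def by (simp add: card_cartesian_product card_cube_roots card_UNIV)
      ultimately show ?thesis unfolding * using True by simp
    qed
  qed
qed

end

theorem theorem3p3:
  fixes e q :: nat
    and \<epsilon> \<delta> :: "'a::{field,finite}"
    and G :: "'a mat"
  assumes "e \<ge> 3" and "odd e" and "e mod 4 = 3"
    and "q = 2 ^ e"
    and "card (UNIV :: 'a set) = q ^ 2"
    and "\<epsilon> \<notin> subfield_Fq q"
    and "\<delta> \<in> subfield_Fq q" and "\<delta> \<noteq> 1"
    and "abs_trace e \<delta> = 1"
    and "\<epsilon> ^ 2 + \<epsilon> + \<delta> = 0"
    and "generates_code_of 3 (variety e 3 \<epsilon>) G"
  shows "{int (hamming_weight c) | c. c \<in> lin_code G \<and> c \<noteq> 0\<^sub>v (card (variety e 3 \<epsilon>))}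
    \<subseteq> {int q ^ 5,
       int q ^ 5 - int q ^ 3 + 3 * int q ^ 2,
       int q ^ 5 - int q ^ 3 + 2 * int q ^ 2,
       int q ^ 5 - int q ^ 3 + 3 * int q ^ 2 + int q - 2,
       int q ^ 5 - int q ^ 3 + 2 * int q ^ 2 + int q - 2}"
proof (rule subsetI)
  interpret fq2 e q \<epsilon> \<delta>
    using assms by unfold_locales
  let ?n = "card (variety e 3 \<epsilon>)"
  have G: "G \<in> carrier_mat 4 ?n"
    using assms(11) by (simp add: generates_code_of_def)
  fix x assume "x \<in> {int (hamming_weight c) | c. c \<in> lin_code G \<and> c \<noteq> 0\<^sub>v ?n}"
  then obtain c where c: "c \<in> lin_code G" "c \<noteq> 0\<^sub>v ?n" and x: "x = int (hamming_weight c)"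
    by blast
  obtain u where u: "u \<in> carrier_vec 4" and dim: "dim_vec c = ?n"
    and nth: "\<And>j. j < ?n \<Longrightarrow> c $ j = col G j \<bullet> u"
    using lin_codeE[OF c(1) G] by metis
  have "u \<noteq> 0\<^sub>v 4"
  proof
    assume "u = 0\<^sub>v 4"
    then have "c = 0\<^sub>v ?n"
      using dim nth G by (intro eq_vecI) (auto simp: col_carrier_vec)
    with c(2) show False by simp
  qed
  moreover have "hamming_weight c = card {v \<in> normalized_points. v \<bullet> u \<noteq> 0}"
    using assms(11) u dim nth unfolding variety_eq
    by (intro hamming_weight_eq_card[of 3 _ G]) (auto simp: normalized_points_def)
  ultimately show "x \<in> {int q ^ 5,
       int q ^ 5 - int q ^ 3 + 3 * int q ^ 2,
       int q ^ 5 - int q ^ 3 + 2 * int q ^ 2,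
       int q ^ 5 - int q ^ 3 + 3 * int q ^ 2 + int q - 2,
       int q ^ 5 - int q ^ 3 + 2 * int q ^ 2 + int q - 2}"
    using weight_cases[OF assms(3) u] x by simp
qed

end
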